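(* Let $C_{240}=\{x/\sqrt2: x\in E_8,\ |x|^2=2\}\subset\mathbb S^7$ and $C_{2160}=\{x/2: x\in E_8,\ |x|^2=4\}\subset\mathbb S^7$. Then: (a) for every potential $h$ with $h^{(8)}(t)>0$, $h^{(9)}(t)>0$, $h^{(10)}(t)>0$ for $t\in(-1,1)$, $m^h(C_{240})=14h(-\tfrac{\sqrt2}{2})+64h(-\tfrac{\sqrt2}{4})+84h(0)+64h(\tfrac{\sqrt2}{4})+14h(\tfrac{\sqrt2}{2})$ and $m^h(C_{2160})=126h(-\tfrac{\sqrt2}{2})+576h(-\tfrac{\sqrt2}{4})+756h(0)+576h(\tfrac{\sqrt2}{4})+126h(\tfrac{\sqrt2}{2})$, so that in particular $m^h(C_{240})/240=m^h(C_{2160})/2160$; (b) $(C_{240},C_{2160})$ is a universal polar dual pair: for every strictly absolutely monotone $h$, the set of minimizers on $\mathbb S^7$ of $U_h(\cdot,C_{240})$ is exactly $C_{2160}$, and the set of minimizers of $U_h(\cdot,C_{2160})$ is exactly $C_{240}$. (Thus $(C_{240},C_{2160})$ is a maximal PULB-optimal pair.)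
   Context: $E_8=\{x\in\mathbb Z^8\cup(\mathbb Z+\tfrac12)^8:\ \sum_i x_i\in2\mathbb Z\}$. A potential is a function $h:[-1,1]\to(-\infty,+\infty]$, continuous in the extended sense and finite on $[-1,1)$. For a finite $X\subset\mathbb S^{d-1}$, $U_h(x,X)=\sum_{y\in X}h(x\cdot y)$ and $m^h(X)=\min_{x\in\mathbb S^{d-1}}U_h(x,X)$. $h$ is strictly absolutely monotone if $h^{(j)}(t)>0$ for all $j\ge0$ and $t\in(-1,1)$. *)

theory Defs
  imports "HOL-Analysis.Analysis"
begin

definition E8 :: "(real^8) set" where
  "E8 = {x. ((\<forall>i. x $ i \<in> \<int>) \<or> (\<forall>i. x $ i - 1/2 \<in> \<int>)) \<and>
            (\<exists>k::int. (\<Sum>i\<in>UNIV. x $ i) = 2 * of_int k)}"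

definition C240 :: "(real^8) set" where
  "C240 = (\<lambda>x. x /\<^sub>R sqrt 2) ` {x \<in> E8. (norm x)\<^sup>2 = 2}"

definition C2160 :: "(real^8) set" where
  "C2160 = (\<lambda>x. x /\<^sub>R 2) ` {x \<in> E8. (norm x)\<^sup>2 = 4}"

text \<open>Values of a potential outside \<open>[-1,1]\<close> are irrelevant: only inner products of unit
  vectors and derivatives on \<open>(-1,1)\<close> are ever taken.\<close>

definition potential :: "(real \<Rightarrow> ereal) \<Rightarrow> bool" where
  "potential h \<longleftrightarrow> continuous_on {-1..1} h \<and> (\<forall>t\<in>{-1..1}. h t \<noteq> -\<infinity>) \<and>
     (\<forall>t\<in>{-1..<1}. h t \<noteq> \<infinity>)"

text \<open>The \<open>j\<close>-th derivative of the potential, which is real-valued on \<open>(-1,1)\<close>. As \<^const>\<open>deriv\<close>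
  is total, existence of the derivatives up to order \<open>n\<close> is expressed separately.\<close>

definition hderiv :: "nat \<Rightarrow> (real \<Rightarrow> ereal) \<Rightarrow> real \<Rightarrow> real" where
  "hderiv j h = (deriv ^^ j) (\<lambda>t. real_of_ereal (h t))"

definition times_differentiable :: "nat \<Rightarrow> (real \<Rightarrow> ereal) \<Rightarrow> bool" where
  "times_differentiable n h \<longleftrightarrow>
     (\<forall>j<n. \<forall>t\<in>{-1<..<1}. hderiv j h differentiable (at t))"

definition strictly_absolutely_monotone :: "(real \<Rightarrow> ereal) \<Rightarrow> bool" where
  "strictly_absolutely_monotone h \<longleftrightarrow>
     (\<forall>n. times_differentiable n h) \<and> (\<forall>j. \<forall>t\<in>{-1<..<1}. hderiv j h t > 0)"

definition U :: "(real \<Rightarrow> ereal) \<Rightarrow> 'a::euclidean_space \<Rightarrow> 'a set \<Rightarrow> ereal" where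
  "U h x X = (\<Sum>y\<in>X. h (x \<bullet> y))"

definition polarization :: "(real \<Rightarrow> ereal) \<Rightarrow> 'a::euclidean_space set \<Rightarrow> ereal" where
  "polarization h X = (LEAST v. v \<in> (\<lambda>x. U h x X) ` sphere 0 1)"

definition minimizers :: "(real \<Rightarrow> ereal) \<Rightarrow> 'a::euclidean_space set \<Rightarrow> 'a set" where
  "minimizers h X = {x \<in> sphere 0 1. \<forall>y\<in>sphere 0 1. U h x X \<le> U h y X}"

definition universal_polar_dual_pair :: "'a::euclidean_space set \<Rightarrow> 'a set \<Rightarrow> bool" where
  "universal_polar_dual_pair C D \<longleftrightarrow>
     (\<forall>h. potential h \<and> strictly_absolutely_monotone h \<longrightarrow>
        minimizers h C = D \<and> minimizers h D = C)"

lemma C240_sphere: "C240 \<subseteq> sphere 0 1"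
proof -
  have "norm (x /\<^sub>R sqrt 2) = 1" if "(norm x)\<^sup>2 = 2" for x :: "real^8"
  proof -
    have "norm x = sqrt 2"
      using real_sqrt_unique[OF that] by simp
    moreover have "norm (x /\<^sub>R sqrt 2) = inverse (sqrt 2) * norm x"
      by simp
    ultimately show ?thesis by (simp only:) simp
  qed
  then show ?thesis
    unfolding C240_def by (auto simp del: norm_scaleR)
qed

lemma C2160_sphere: "C2160 \<subseteq> sphere 0 1"
proof -
  have "norm x = 2" if "(norm x)\<^sup>2 = 4" for x :: "real^8"
    using that power2_eq_iff_nonneg[of "norm x" 2] by simp
  then show ?thesis
    unfolding C2160_def by auto
qed

lemma continuous_on_U:
  fixes X :: "'a::euclidean_space set"
  assumes h: "potential h" and "finite X" "X \<subseteq> sphere 0 1"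
  shows "continuous_on (sphere 0 1) (\<lambda>x. U h x X) \<and> (\<forall>x\<in>sphere 0 1. U h x X \<noteq> -\<infinity>)"
  using assms(2,3)
proof (induction X rule: finite_induct)
  case empty
  then show ?case by (simp add: U_def)
next
  case (insert y X)
  have range: "x \<bullet> y \<in> {-1..1}" if "x \<in> sphere 0 1" for x
    using that insert.prems Cauchy_Schwarz_ineq2[of x y] by (auto simp: abs_le_iff)
  have c: "continuous_on (sphere 0 1) (\<lambda>x. h (x \<bullet> y))"
    using h range unfolding potential_def
    by (intro continuous_on_compose2[of "{-1..1}" h _ "\<lambda>x. x \<bullet> y"] continuous_intros) auto
  have n: "h (x \<bullet> y) \<noteq> -\<infinity>" if "x \<in> sphere 0 1" for x
    using h range[OF that] unfolding potential_def by blast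
  have eq: "U h x (insert y X) = h (x \<bullet> y) + U h x X" for x
    using insert by (simp add: U_def)
  have "continuous_on (sphere 0 1) (\<lambda>x. h (x \<bullet> y) + U h x X)"
    using c n insert unfolding continuous_on_def
    by (auto intro!: tendsto_add_ereal_general)
  then show ?case using n insert by (simp add: eq)
qed

text \<open>The minimum defining \<^const>\<open>polarization\<close> is attained, so \<^const>\<open>Least\<close> is meaningful there.\<close>

lemma polarization_is_min:
  fixes X :: "'a::euclidean_space set"
  assumes "potential h" "finite X" "X \<subseteq> sphere 0 1"
  shows "\<exists>x\<in>sphere 0 1. U h x X = polarization h X"
    and "\<forall>x\<in>sphere 0 1. polarization h X \<le> U h x X"
proof -
  obtain x where x: "x \<in> sphere 0 1" "\<And>y. y \<in> sphere 0 1 \<Longrightarrow> U h x X \<le> U h y X"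
    using continuous_attains_inf[of "sphere (0::'a) 1" "\<lambda>x. U h x X"] continuous_on_U[OF assms]
    by auto
  have "polarization h X = U h x X"
    unfolding polarization_def by (rule Least_equality) (use x in auto)
  then show "\<exists>x\<in>sphere 0 1. U h x X = polarization h X"
    and "\<forall>x\<in>sphere 0 1. polarization h X \<le> U h x X"
    using x by auto
qed

end

theory Submission
  imports Defs "HOL-Computational_Algebra.Polynomial"
begin

text \<open>
  Let \<open>M\<^sub>k(x) = \<Sum>y\<in>X. (x \<bullet> y)^k\<close> for one of the two codes \<open>X\<close>. On the sphere \<open>M\<^sub>2, M\<^sub>4, M\<^sub>6\<close> are
  constant and \<open>M\<^sub>1\<^sub>0 = 15/8 M\<^sub>8 + const\<close>, i.e. the code averages harmonics of degree 2, 4, 6 and 10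
  to zero, but not those of degree 8. Summing
  \<open>\<Pi>(t) = t\<^sup>2 (t\<^sup>2 - 1/8)\<^sup>2 (t\<^sup>2 - 1/2)\<^sup>2 = t^10 - 5/4 t^8 + \<dots> \<ge> 0\<close> over the code gives
  \<open>5/8 M\<^sub>8(x) + const \<ge> 0\<close>, with equality iff all inner products \<open>x \<bullet> y\<close> are zeros of \<open>\<Pi>\<close>. Since
  \<open>E\<^sub>8\<close> is integral and self-dual, the latter happens exactly when \<open>x\<close> lies in the other code.

  The codes are antipodal, so \<open>h\<close> may be replaced by its even part. The even polynomial \<open>q\<close> of degree 8
  that interpolates it to second order at the zeros of \<open>\<Pi>\<close> lies below it because \<open>h^(10) > 0\<close>, and has
  a positive leading coefficient because \<open>h^(8) > 0\<close>. Hence the potential is bounded below by a constant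
  plus a positive multiple of \<open>M\<^sub>8(x)\<close>, with equality on the dual code, where \<open>M\<^sub>8\<close> is minimal.
\<close>

subsection \<open>Moments of integer vectors of given norm\<close>

text \<open>Entries outside \<open>I\<close> are pinned to 0, so every vector is represented by
  exactly one function and a shell can be built up one coordinate at a time.\<close>

definition shell :: "int set \<Rightarrow> 'i set \<Rightarrow> int \<Rightarrow> ('i \<Rightarrow> int) set" where
  "shell A I w = {a. (\<forall>i. if i \<in> I then a i \<in> A else a i = 0) \<and> (\<Sum>i\<in>I. (a i)\<^sup>2) = w}"

lemma shell_neg: "w < 0 \<Longrightarrow> shell A I w = {}"
  unfolding shell_def by (auto simp: sum_nonneg leD)

lemma shell_empty: "shell A {} w = (if w = 0 then {\<lambda>_. 0} else {})"
  unfolding shell_def by auto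

lemma shell_insert:
  assumes "finite I" "i \<notin> I" "B \<subseteq> A"
    and "\<And>c. c \<in> A - B \<Longrightarrow> shell A I (w - c\<^sup>2) = {}"
  shows "shell A (insert i I) w = (\<lambda>(c, a). a(i := c)) ` (SIGMA c:B. shell A I (w - c\<^sup>2))"
proof (intro equalityI subsetI)
  fix a assume a: "a \<in> shell A (insert i I) w"
  define b where "b = a(i := 0)"
  have s: "(\<Sum>j\<in>I. (b j)\<^sup>2) = (\<Sum>j\<in>I. (a j)\<^sup>2)"
    using assms(2) unfolding b_def by (intro sum.cong) auto
  have b: "b \<in> shell A I (w - (a i)\<^sup>2)"
    using a assms(1,2) s unfolding shell_def by (auto simp: b_def split: if_splits)
  have "a i \<in> A" using a unfolding shell_def by force
  then have "a i \<in> B" using assms(4) b by blast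
  moreover have "a = b(i := a i)" by (simp add: b_def)
  ultimately show "a \<in> (\<lambda>(c, a). a(i := c)) ` (SIGMA c:B. shell A I (w - c\<^sup>2))"
    using b by (intro image_eqI[of _ _ "(a i, b)"]) auto
next
  fix a assume "a \<in> (\<lambda>(c, a). a(i := c)) ` (SIGMA c:B. shell A I (w - c\<^sup>2))"
  then obtain c b where cb: "c \<in> B" "b \<in> shell A I (w - c\<^sup>2)" "a = b(i := c)" by auto
  have "(\<Sum>j\<in>I. (a j)\<^sup>2) = (\<Sum>j\<in>I. (b j)\<^sup>2)"
    using assms(2) unfolding cb(3) by (intro sum.cong) auto
  then show "a \<in> shell A (insert i I) w"
    using cb assms(1-3) unfolding shell_def by (auto split: if_splits)
qed

lemma sum_shell_insert:
  assumes "finite I" "i \<notin> I" "finite B" "B \<subseteq> A"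
    and "\<And>c. c \<in> A - B \<Longrightarrow> shell A I (w - c\<^sup>2) = {}"
    and "\<And>c. c \<in> B \<Longrightarrow> finite (shell A I (w - c\<^sup>2))"
  shows "(\<Sum>a\<in>shell A (insert i I) w. f a) = (\<Sum>c\<in>B. \<Sum>a\<in>shell A I (w - c\<^sup>2). f (a(i := c)))"
proof -
  have inj: "inj_on (\<lambda>(c, a). a(i := c)) (SIGMA c:B. shell A I (w - c\<^sup>2))"
  proof (rule inj_onI, clarsimp)
    fix c a c' a' assume a: "a \<in> shell A I (w - c\<^sup>2)" "a' \<in> shell A I (w - c'\<^sup>2)"
      and e: "a(i := c) = a'(i := c')"
    have "a i = 0" "a' i = 0" using a assms(2) unfolding shell_def by auto
    then show "c = c' \<and> a = a'" using e by (metis fun_upd_idem_iff fun_upd_same fun_upd_upd)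
  qed
  have "(\<Sum>a\<in>shell A (insert i I) w. f a)
    = sum (f \<circ> (\<lambda>(c, a). a(i := c))) (SIGMA c:B. shell A I (w - c\<^sup>2))"
    using shell_insert[OF assms(1,2,4,5)] sum.reindex[OF inj] by simp
  also have "\<dots> = (\<Sum>c\<in>B. \<Sum>a\<in>shell A I (w - c\<^sup>2). f (a(i := c)))"
    using assms by (subst sum.Sigma) (auto simp: case_prod_unfold)
  finally show ?thesis .
qed

lemma finite_shell: "finite I \<Longrightarrow> finite (shell A I w)"
proof (induction I arbitrary: w rule: finite_induct)
  case (insert i I)
  have "finite {c::int. c\<^sup>2 \<le> w}"
  proof (rule finite_subset)
    show "{c. c\<^sup>2 \<le> w} \<subseteq> {-w..w}"
    proof
      fix c assume "c \<in> {c. c\<^sup>2 \<le> w}"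
      moreover have "\<bar>c\<bar> \<le> c\<^sup>2" using self_le_power[of "\<bar>c\<bar>" 2] by (cases "c = 0") auto
      ultimately show "c \<in> {-w..w}" by auto
    qed
  qed auto
  then show ?case
    using insert by (subst shell_insert[of I i "A \<inter> {c. c\<^sup>2 \<le> w}"]) (auto simp: shell_neg)
qed (simp add: shell_empty)

abbreviation lin :: "('i \<Rightarrow> real) \<Rightarrow> 'i set \<Rightarrow> ('i \<Rightarrow> int) \<Rightarrow> real" where
  "lin x I a \<equiv> \<Sum>i\<in>I. real_of_int (a i) * x i"

lemma lin_update: "finite I \<Longrightarrow> i \<notin> I \<Longrightarrow> lin x (insert i I) (a(i := c)) = lin x I a + of_int c * x i"
  by (subst sum.insert) (auto intro!: sum.cong simp: add.commute)

definition moment :: "int set \<Rightarrow> ('i \<Rightarrow> real) \<Rightarrow> 'i set \<Rightarrow> int \<Rightarrow> nat \<Rightarrow> real" where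
  "moment A x I w k = (\<Sum>a\<in>shell A I w. lin x I a ^ k)"

abbreviation psum :: "('i \<Rightarrow> real) \<Rightarrow> 'i set \<Rightarrow> nat \<Rightarrow> real" where
  "psum x I k \<equiv> \<Sum>i\<in>I. x i ^ (2 * k)"

text \<open>Joint contribution of new coordinates \<open>c\<close> and \<open>-c\<close>, with
  \<open>y = c * x i\<close>. For exponential generating functions it is multiplication by
  \<open>2 cosh (y t)\<close>, so for even \<open>k\<close> only even moments survive.\<close>

definition mcosh :: "int set \<Rightarrow> ('i \<Rightarrow> real) \<Rightarrow> 'i set \<Rightarrow> int \<Rightarrow> real \<Rightarrow> nat \<Rightarrow> real" where
  "mcosh A x I w y k = (\<Sum>a\<in>shell A I w. (lin x I a + y) ^ k + (lin x I a - y) ^ k)"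

lemma mcosh_expand:
  "mcosh A x I w y 0 = 2 * moment A x I w 0"
  "mcosh A x I w y 2 = 2 * moment A x I w 2 + 2 * y^2 * moment A x I w 0"
  "mcosh A x I w y 4 = 2 * moment A x I w 4 + 12 * y^2 * moment A x I w 2 + 2 * y^4 * moment A x I w 0"
  "mcosh A x I w y 6 = 2 * moment A x I w 6 + 30 * y^2 * moment A x I w 4
     + 30 * y^4 * moment A x I w 2 + 2 * y^6 * moment A x I w 0"
  "mcosh A x I w y 8 = 2 * moment A x I w 8 + 56 * y^2 * moment A x I w 6
     + 140 * y^4 * moment A x I w 4 + 56 * y^6 * moment A x I w 2 + 2 * y^8 * moment A x I w 0"
  "mcosh A x I w y 10 = 2 * moment A x I w 10 + 90 * y^2 * moment A x I w 8
     + 420 * y^4 * moment A x I w 6 + 420 * y^6 * moment A x I w 4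
     + 90 * y^8 * moment A x I w 2 + 2 * y^10 * moment A x I w 0"
  unfolding mcosh_def moment_def sum_distrib_left sum.distrib[symmetric]
  by (intro sum.cong refl, algebra)+

text \<open>The new coordinate has \<open>c\<^sup>2 \<le> w\<close>: it lies in
  \<open>{-1, 0, 1}\<close> for \<open>w \<le> 3\<close>, while +-2 first appears at
  \<open>w = 4\<close>, where it uses up the whole squared norm.\<close>

lemma moment_int_insert:
  assumes "finite I" "i \<notin> I"
  shows "moment UNIV x (insert i I) 0 k = moment UNIV x I 0 k"
    and "w \<in> {1, 2, 3} \<Longrightarrow>
      moment UNIV x (insert i I) w k = moment UNIV x I w k + mcosh UNIV x I (w - 1) (x i) k"
    and "moment UNIV x (insert i I) 4 k
      = moment UNIV x I 4 k + mcosh UNIV x I 3 (x i) k + mcosh UNIV x I 0 (2 * x i) k"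
proof -
  have big: "shell UNIV I (w - c\<^sup>2) = {}" if "w < m\<^sup>2" "m \<le> \<bar>c\<bar>" "0 \<le> m" for w m c :: int
    using that power_mono[of m "\<bar>c\<bar>" 2] by (intro shell_neg) auto
  have *: "moment UNIV x (insert i I) w k
     = (\<Sum>c\<in>{-m..m}. \<Sum>a\<in>shell UNIV I (w - c\<^sup>2). (lin x I a + of_int c * x i) ^ k)"
    if "w < (m + 1)\<^sup>2" "0 \<le> m" for w m :: int
  proof -
    have "shell UNIV I (w - c\<^sup>2) = {}" if "c \<in> UNIV - {-m..m}" for c
      using that \<open>0 \<le> m\<close> by (intro big[OF \<open>w < (m + 1)\<^sup>2\<close>]) auto
    then show ?thesis
      unfolding moment_def using assms
      by (subst sum_shell_insert[where B = "{-m..m}"]) (simp_all add: lin_update finite_shell del: fun_upd_apply sum.insert)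
  qed
  have s1: "{-1..1::int} = {-1,0,1}" and s2: "{-2..2::int} = {-2,-1,0,1,2}" by auto
  show "moment UNIV x (insert i I) 0 k = moment UNIV x I 0 k"
    using *[of 0 0] by (simp add: moment_def)
  show "moment UNIV x (insert i I) w k = moment UNIV x I w k + mcosh UNIV x I (w - 1) (x i) k"
    if "w \<in> {1,2,3}"
    using *[of w 1] that unfolding s1
    by (auto simp: moment_def mcosh_def sum.distrib)
  show "moment UNIV x (insert i I) 4 k
      = moment UNIV x I 4 k + mcosh UNIV x I 3 (x i) k + mcosh UNIV x I 0 (2 * x i) k"
    using *[of 4 2] unfolding s2
    by (simp add: moment_def mcosh_def sum.distrib)
qed

lemma psum_insert:
  "finite I \<Longrightarrow> i \<notin> I \<Longrightarrow> psum x (insert i I) k = psum x I k + x i ^ (2 * k)"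
  by simp

lemma real_card_insert: "finite I \<Longrightarrow> i \<notin> I \<Longrightarrow> real (card (insert i I)) = real (card I) + 1"
  by simp

lemma moment_int_0: "finite I \<Longrightarrow> moment UNIV x I 0 k = (if k = 0 then 1 else 0)"
  by (induction I rule: finite_induct) (simp_all add: moment_def[of _ _ "{}"] shell_empty moment_int_insert)

text \<open>
  The closed forms below are the coefficients of
  \<open>exp (\<Sum>i. ln (1 + 2 q cosh (x\<^sub>i t) + 2 q^4 cosh (2 x\<^sub>i t)))\<close>, where \<open>q\<close> marks the squared norm, and for
  the odd vectors those of \<open>exp (\<Sum>i. ln (cosh (x\<^sub>i t)))\<close>, in the second case multiplied by
  \<open>\<Sum>i. cosh (3 x\<^sub>i t) / cosh (x\<^sub>i t)\<close>.
\<close>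

lemma moment_int_1:
  fixes x :: "'i \<Rightarrow> real"
  assumes "finite I"
  defines "n \<equiv> real (card I)" and "s1 \<equiv> psum x I 1" and "s2 \<equiv> psum x I 2"
    and "s3 \<equiv> psum x I 3" and "s4 \<equiv> psum x I 4" and "s5 \<equiv> psum x I 5"
  shows
    "moment UNIV x I 1 0 = 2 * n
     \<and> moment UNIV x I 1 2 = 2 * s1
     \<and> moment UNIV x I 1 4 = 2 * s2
     \<and> moment UNIV x I 1 6 = 2 * s3
     \<and> moment UNIV x I 1 8 = 2 * s4
     \<and> moment UNIV x I 1 10 = 2 * s5"
  using assms(1) unfolding assms(2-)
proof (induction I rule: finite_induct)
  case empty
  show ?case by (simp add: moment_def shell_empty)
next
  case (insert i I)
  note step = moment_int_insert[OF insert.hyps] mcosh_expand insert.IH moment_int_0[OF insert.hyps(1)]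
  show ?case
    unfolding psum_insert[OF insert.hyps] real_card_insert[OF insert.hyps]
    by (intro conjI; simp add: step; algebra)
qed

lemma moment_int_2:
  fixes x :: "'i \<Rightarrow> real"
  assumes "finite I"
  defines "n \<equiv> real (card I)" and "s1 \<equiv> psum x I 1" and "s2 \<equiv> psum x I 2"
    and "s3 \<equiv> psum x I 3" and "s4 \<equiv> psum x I 4" and "s5 \<equiv> psum x I 5"
  shows
    "moment UNIV x I 2 0 = 2 * n^2 - 2 * n
     \<and> moment UNIV x I 2 2 = 4 * n * s1 - 4 * s1
     \<and> moment UNIV x I 2 4 = 4 * n * s2 + 12 * s1^2 - 16 * s2
     \<and> moment UNIV x I 2 6 = 4 * n * s3 + 60 * s1 * s2 - 64 * s3
     \<and> moment UNIV x I 2 8 = 4 * n * s4 + 112 * s1 * s3 + 140 * s2^2 - 256 * s4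
     \<and> moment UNIV x I 2 10 = 4 * n * s5 + 180 * s1 * s4 + 840 * s2 * s3 - 1024 * s5"
  using assms(1) unfolding assms(2-)
proof (induction I rule: finite_induct)
  case empty
  show ?case by (simp add: moment_def shell_empty)
next
  case (insert i I)
  note step = moment_int_insert[OF insert.hyps] mcosh_expand insert.IH moment_int_0[OF insert.hyps(1)]
    moment_int_1[OF insert.hyps(1)]
  show ?case
    unfolding psum_insert[OF insert.hyps] real_card_insert[OF insert.hyps]
    by (intro conjI; simp add: step; algebra)
qed

lemma moment_int_3:
  fixes x :: "'i \<Rightarrow> real"
  assumes "finite I"
  defines "n \<equiv> real (card I)" and "s1 \<equiv> psum x I 1" and "s2 \<equiv> psum x I 2"
    and "s3 \<equiv> psum x I 3" and "s4 \<equiv> psum x I 4" and "s5 \<equiv> psum x I 5"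
  shows
    "moment UNIV x I 3 0 = (4 * n^3 - 12 * n^2 + 8 * n) / 3
     \<and> moment UNIV x I 3 2 = 4 * n^2 * s1 - 12 * n * s1 + 8 * s1
     \<and> moment UNIV x I 3 4 = 4 * n^2 * s2 + 24 * n * s1^2 - 36 * n * s2 - 48 * s1^2 + 56 * s2
     \<and> moment UNIV x I 3 6 = 4 * n^2 * s3 + 120 * n * s1 * s2 - 132 * n * s3 + 120 * s1^3 - 600
        * s1 * s2 + 488 * s3
     \<and> moment UNIV x I 3 8 = 4 * n^2 * s4 + 224 * n * s1 * s3 + 280 * n * s2^2 - 516 * n * s4 +
        1680 * s1^2 * s2 - 3808 * s1 * s3 - 2240 * s2^2 + 4376 * s4
     \<and> moment UNIV x I 3 10 = 4 * n^2 * s5 + 360 * n * s1 * s4 + 1680 * n * s2 * s3 - 2052 * n *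
        s5 + 5040 * s1^2 * s3 + 12600 * s1 * s2^2 - 23400 * s1 * s4 - 33600 * s2 * s3 + 39368 *
        s5"
  using assms(1) unfolding assms(2-)
proof (induction I rule: finite_induct)
  case empty
  show ?case by (simp add: moment_def shell_empty)
next
  case (insert i I)
  note step = moment_int_insert[OF insert.hyps] mcosh_expand insert.IH moment_int_0[OF insert.hyps(1)]
    moment_int_2[OF insert.hyps(1)]
  show ?case
    unfolding psum_insert[OF insert.hyps] real_card_insert[OF insert.hyps]
    by (intro conjI; simp add: step; algebra)
qed

lemma moment_int_4:
  fixes x :: "'i \<Rightarrow> real"
  assumes "finite I"
  defines "n \<equiv> real (card I)" and "s1 \<equiv> psum x I 1" and "s2 \<equiv> psum x I 2"
    and "s3 \<equiv> psum x I 3" and "s4 \<equiv> psum x I 4" and "s5 \<equiv> psum x I 5"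
  shows
    "moment UNIV x I 4 0 = (2 * n^4 - 12 * n^3 + 22 * n^2 - 6 * n) / 3
     \<and> moment UNIV x I 4 2 = (8 * n^3 * s1 - 48 * n^2 * s1 + 88 * n * s1 - 24 * s1) / 3
     \<and> moment UNIV x I 4 4 = (8 * n^3 * s2 + 72 * n^2 * s1^2 - 120 * n^2 * s2 - 360 * n * s1^2 +
        448 * n * s2 + 432 * s1^2 - 384 * s2) / 3
     \<and> moment UNIV x I 4 6 = (8 * n^3 * s3 + 360 * n^2 * s1 * s2 - 408 * n^2 * s3 + 720 * n *
        s1^3 - 3960 * n * s1 * s2 + 3328 * n * s3 - 2160 * s1^3 + 8640 * s1 * s2 - 6144 * s3) / 3
     \<and> moment UNIV x I 4 8 = (8 * n^3 * s4 + 672 * n^2 * s1 * s3 + 840 * n^2 * s2^2 - 1560 * n^2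
        * s4 + 10080 * n * s1^2 * s2 - 23520 * n * s1 * s3 - 14280 * n * s2^2 + 27808 * n * s4 +
        5040 * s1^4 - 60480 * s1^2 * s2 + 104832 * s1 * s3 + 50400 * s2^2 - 98304 * s4) / 3
     \<and> moment UNIV x I 4 10 = (8 * n^3 * s5 + 1080 * n^2 * s1 * s4 + 5040 * n^2 * s2 * s3 - 6168
        * n^2 * s5 + 30240 * n * s1^2 * s3 + 75600 * n * s1 * s2^2 - 141480 * n * s1 * s4 - 206640
        * n * s2 * s3 + 242368 * n * s5 + 151200 * s1^3 * s2 - 544320 * s1^2 * s3 - 680400 * s1 *
        s2^2 + 1321920 * s1 * s4 + 1330560 * s2 * s3 - 1572864 * s5) / 3"
  using assms(1) unfolding assms(2-)
proof (induction I rule: finite_induct)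
  case empty
  show ?case by (simp add: moment_def shell_empty)
next
  case (insert i I)
  \<comment> \<open>A new coordinate +-1 leaves squared norm 3 and +-2 leaves 0, so the earlier
    levels enter only through \<open>moment_int_3\<close> and \<open>moment_int_0\<close>.\<close>
  note step = moment_int_insert[OF insert.hyps] mcosh_expand insert.IH moment_int_0[OF insert.hyps(1)]
    moment_int_3[OF insert.hyps(1)]
  show ?case
    unfolding psum_insert[OF insert.hyps] real_card_insert[OF insert.hyps]
    by (intro conjI; simp add: step; algebra)
qed

section \<open>Vectors with odd coordinates: the two lowest levels\<close>

definition odds :: "int set" where "odds = {c. odd c}"

lemma shell_odds_small:
  assumes "finite I" "w < int (card I)"
  shows "shell odds I w = {}"
proof -
  have "int (card I) \<le> (\<Sum>i\<in>I. (a i)\<^sup>2)" if "\<forall>i\<in>I. odd (a i)" for a :: "'a \<Rightarrow> int"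
  proof -
    have "(\<Sum>i\<in>I. 1) \<le> (\<Sum>i\<in>I. (a i)\<^sup>2)"
    proof (rule sum_mono)
      fix i assume "i \<in> I"
      then have "a i \<noteq> 0" using that by force
      then show "1 \<le> (a i)\<^sup>2" by (smt (verit) zero_less_power2)
    qed
    then show ?thesis by simp
  qed
  then show ?thesis using assms(2) unfolding shell_def odds_def by (auto simp: not_le[symmetric])
qed

text \<open>Odd squares are 1, 9, 25 and so on: on the lowest level \<open>card I\<close> all
  coordinates are +-1, and on the next one, \<open>card I + 8\<close>, exactly one is +-3. For eight
  coordinates these are the levels 8 and 16, four times the squared norms 2 and 4 of the halved
  vectors.\<close>

lemma sum_shell_odds_insert:
  fixes f :: "('i \<Rightarrow> int) \<Rightarrow> 'b::comm_monoid_add"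
  assumes "finite I" "i \<notin> I"
  defines "g \<equiv> \<lambda>c a. f (a(i := c))" and "n \<equiv> int (card I)" and "n' \<equiv> int (card (insert i I))"
  shows "(\<Sum>a\<in>shell odds (insert i I) n'. f a) = (\<Sum>a\<in>shell odds I n. g 1 a + g (-1) a)"
    and "(\<Sum>a\<in>shell odds (insert i I) (n' + 8). f a)
      = (\<Sum>a\<in>shell odds I (n + 8). g 1 a + g (-1) a) + (\<Sum>a\<in>shell odds I n. g 3 a + g (-3) a)"
proof -
  have n': "n' = n + 1" using assms by simp
  \<comment> \<open>A coordinate of modulus at least 5 costs at least 25, which leaves less than the
    minimum \<open>n\<close> for the others.\<close>
  have emp: "shell odds I (n' + m - c\<^sup>2) = {}" if "c \<in> odds - {-1,1,-3,3}" "m \<le> 8" for c m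
  proof -
    have "5 \<le> \<bar>c\<bar>" using that unfolding odds_def by (auto, presburger)
    then have "25 \<le> c\<^sup>2" using power_mono[of 5 "\<bar>c\<bar>" 2] by simp
    then show ?thesis
      using that n' assms(1) by (intro shell_odds_small) (auto simp: n_def)
  qed
  have *: "(\<Sum>a\<in>shell odds (insert i I) (n' + m). f a)
    = (\<Sum>c\<in>{-1,1,-3,3}. \<Sum>a\<in>shell odds I (n' + m - c\<^sup>2). g c a)" if "m \<le> 8" for m
    unfolding g_def
    by (rule sum_shell_insert[OF assms(1,2) _ _ emp[OF _ that]])
      (simp_all add: finite_shell assms(1) odds_def)
  \<comment> \<open>The general formula with \<open>m = 0\<close> still lists the coordinates +-3;
    their terms are empty on the lowest level.\<close>
  have e: "shell odds I (n' - 9) = {}"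
    using assms(1) n' by (intro shell_odds_small) (auto simp: n_def)
  show "(\<Sum>a\<in>shell odds (insert i I) n'. f a) = (\<Sum>a\<in>shell odds I n. g 1 a + g (-1) a)"
    using *[of 0] e by (simp add: n' sum.distrib add.commute)
  show "(\<Sum>a\<in>shell odds (insert i I) (n' + 8). f a)
      = (\<Sum>a\<in>shell odds I (n + 8). g 1 a + g (-1) a) + (\<Sum>a\<in>shell odds I n. g 3 a + g (-3) a)"
    using *[of 8] by (simp add: n' sum.distrib ac_simps)
qed

lemma moment_odd_insert:
  assumes "finite I" "i \<notin> I"
  shows "moment odds x (insert i I) (int (card (insert i I))) k = mcosh odds x I (int (card I)) (x i) k"
    and "moment odds x (insert i I) (int (card (insert i I)) + 8) k
      = mcosh odds x I (int (card I) + 8) (x i) k + mcosh odds x I (int (card I)) (3 * x i) k"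
proof -
  note * = sum_shell_odds_insert[OF assms, where f = "\<lambda>a. lin x (insert i I) a ^ k"]
  show "moment odds x (insert i I) (int (card (insert i I))) k = mcosh odds x I (int (card I)) (x i) k"
    unfolding moment_def * mcosh_def
    by (simp only: lin_update[OF assms]) simp
  show "moment odds x (insert i I) (int (card (insert i I)) + 8) k
      = mcosh odds x I (int (card I) + 8) (x i) k + mcosh odds x I (int (card I)) (3 * x i) k"
    unfolding moment_def * mcosh_def
    by (simp only: lin_update[OF assms]) simp
qed

lemma moment_odd_0:
  fixes x :: "'i \<Rightarrow> real"
  assumes "finite I"
  defines "n \<equiv> real (card I)" and "s1 \<equiv> psum x I 1" and "s2 \<equiv> psum x I 2"
    and "s3 \<equiv> psum x I 3" and "s4 \<equiv> psum x I 4" and "s5 \<equiv> psum x I 5"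
  shows
    "moment odds x I (int (card I)) 0 = 2 ^ card I * 1
     \<and> moment odds x I (int (card I)) 2 = 2 ^ card I * s1
     \<and> moment odds x I (int (card I)) 4 = 2 ^ card I * (3 * s1^2 - 2 * s2)
     \<and> moment odds x I (int (card I)) 6 = 2 ^ card I * (15 * s1^3 - 30 * s1 * s2 + 16 * s3)
     \<and> moment odds x I (int (card I)) 8 = 2 ^ card I * (105 * s1^4 - 420 * s1^2 * s2 + 448 * s1
        * s3 + 140 * s2^2 - 272 * s4)
     \<and> moment odds x I (int (card I)) 10 = 2 ^ card I * (945 * s1^5 - 6300 * s1^3 * s2 + 10080 *
        s1^2 * s3 + 6300 * s1 * s2^2 - 12240 * s1 * s4 - 6720 * s2 * s3 + 7936 * s5)"
  using assms(1) unfolding assms(2-)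
proof (induction I rule: finite_induct)
  case empty
  show ?case by (simp add: moment_def shell_empty)
next
  case (insert i I)
  note step = moment_odd_insert[OF insert.hyps] mcosh_expand insert.IH
  show ?case
    by (intro conjI; simp only: step psum_insert[OF insert.hyps] real_card_insert[OF insert.hyps];
        simp add: insert.hyps; algebra)
qed

lemma moment_odd_1:
  fixes x :: "'i \<Rightarrow> real"
  assumes "finite I"
  defines "n \<equiv> real (card I)" and "s1 \<equiv> psum x I 1" and "s2 \<equiv> psum x I 2"
    and "s3 \<equiv> psum x I 3" and "s4 \<equiv> psum x I 4" and "s5 \<equiv> psum x I 5"
  shows
    "moment odds x I (int (card I) + 8) 0 = 2 ^ card I * n
     \<and> moment odds x I (int (card I) + 8) 2 = 2 ^ card I * (n * s1 + 8 * s1)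
     \<and> moment odds x I (int (card I) + 8) 4 = 2 ^ card I * (3 * n * s1^2 - 2 * n * s2 + 48 *
        s1^2 + 32 * s2)
     \<and> moment odds x I (int (card I) + 8) 6 = 2 ^ card I * (15 * n * s1^3 - 30 * n * s1 * s2 +
        16 * n * s3 + 360 * s1^3 + 240 * s1 * s2 + 128 * s3)
     \<and> moment odds x I (int (card I) + 8) 8 = 2 ^ card I * (105 * n * s1^4 - 420 * n * s1^2 * s2
        + 448 * n * s1 * s3 + 140 * n * s2^2 - 272 * n * s4 + 3360 * s1^4 + 7168 * s1 * s3 - 4480
        * s2^2 + 512 * s4)
     \<and> moment odds x I (int (card I) + 8) 10 = 2 ^ card I * (945 * n * s1^5 - 6300 * n * s1^3 *
        s2 + 10080 * n * s1^2 * s3 + 6300 * n * s1 * s2^2 - 12240 * n * s1 * s4 - 6720 * n * s2 *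
        s3 + 7936 * n * s5 + 37800 * s1^5 - 50400 * s1^3 * s2 + 241920 * s1^2 * s3 - 151200 * s1 *
        s2^2 - 74880 * s1 * s4 + 53760 * s2 * s3 + 2048 * s5)"
  using assms(1) unfolding assms(2-)
proof (induction I rule: finite_induct)
  case empty
  show ?case by (simp add: moment_def shell_empty)
next
  case (insert i I)
  note step = moment_odd_insert[OF insert.hyps] mcosh_expand insert.IH
    moment_odd_0[OF insert.hyps(1)]
  show ?case
    by (intro conjI; simp only: step psum_insert[OF insert.hyps] real_card_insert[OF insert.hyps];
        simp add: insert.hyps; algebra)
qed

text \<open>
  For \<open>a \<in> \<int>\<^sup>8\<close> with odd entries the product of the \<open>chi (a i)\<close> is 1 iff \<open>a / 2\<close> has an even coordinate
  sum, so this character singles out the half-integral vectors that belong to \<open>E\<^sub>8\<close>.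
\<close>

definition chi :: "int \<Rightarrow> real" where
  "chi c = (if c mod 4 = 1 then 1 else -1)"

definition chi_moment :: "('i \<Rightarrow> real) \<Rightarrow> 'i set \<Rightarrow> int \<Rightarrow> nat \<Rightarrow> real" where
  "chi_moment x I w k = (\<Sum>a\<in>shell odds I w. (\<Prod>i\<in>I. chi (a i)) * lin x I a ^ k)"

text \<open>\<open>chi\<close> changes sign under \<open>c \<mapsto> -c\<close> for odd
  \<open>c\<close>, so the contributions of \<open>c\<close> and \<open>-c\<close> are subtracted:
  the generating function is multiplied by \<open>2 sinh (y t)\<close> instead of
  \<open>2 cosh (y t)\<close>.\<close>

definition msinh :: "('i \<Rightarrow> real) \<Rightarrow> 'i set \<Rightarrow> int \<Rightarrow> real \<Rightarrow> nat \<Rightarrow> real" where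
  "msinh x I w y k =
     (\<Sum>a\<in>shell odds I w. (\<Prod>i\<in>I. chi (a i)) * ((lin x I a + y) ^ k - (lin x I a - y) ^ k))"

lemma msinh_binomial:
  "msinh x I w y k
     = (\<Sum>j\<le>k. real (k choose j) * (1 - (-1) ^ (k - j)) * y ^ (k - j) * chi_moment x I w j)"
proof -
  have *: "(L + y) ^ k - (L - y) ^ k
    = (\<Sum>j\<le>k. real (k choose j) * (1 - (-1) ^ (k - j)) * y ^ (k - j) * L ^ j)" for L
    using binomial_ring[of L y k] binomial_ring[of L "- y" k]
    by (simp add: power_minus[of y] sum_subtractf[symmetric] algebra_simps)
  show ?thesis
    unfolding msinh_def chi_moment_def * sum_distrib_left
    by (subst sum.swap) (simp add: algebra_simps)
qed

text \<open>A series starting at order \<open>n\<close> with no term of order \<open>n + 1\<close>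
  is multiplied by \<open>2 sinh (y t) = 2 (y t + (y t)^3 / 6 + ...)\<close>. The product starts at
  order \<open>n + 1\<close>, again has a gap after its first term, and its next coefficient is
  determined by the two known ones.\<close>

lemma msinh_low:
  fixes n :: nat
  assumes "\<And>m. m < n \<Longrightarrow> chi_moment x I w m = 0" and "chi_moment x I w (n + 1) = 0"
  shows "m < n + 1 \<Longrightarrow> msinh x I w y m = 0"
    and "msinh x I w y (n + 1) = 2 * (real n + 1) * y * chi_moment x I w n"
    and "msinh x I w y (n + 2) = 0"
    and "msinh x I w y (n + 3) = 2 * (real n + 3) * y * chi_moment x I w (n + 2)
      + (real n + 3) * (real n + 2) * (real n + 1) / 3 * y ^ 3 * chi_moment x I w n"
proof -
  let ?f = "\<lambda>k j. real (k choose j) * (1 - (-1) ^ (k - j)) * y ^ (k - j) * chi_moment x I w j"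
  have 0: "sum (?f k) {..<n} = 0" for k
    using assms(1) by (intro sum.neutral) auto
  show "msinh x I w y m = 0" if "m < n + 1"
  proof -
    have "?f m j = 0" if "j \<le> m" for j
      using that \<open>m < n + 1\<close> assms(1)[of j] by (cases "j = m") auto
    then show ?thesis unfolding msinh_binomial by (intro sum.neutral) auto
  qed
  have S: "{..n + 1} = insert (n + 1) (insert n {..<n})"
    "{..n + 2} = insert (n + 2) (insert (n + 1) (insert n {..<n}))"
    "{..n + 3} = insert (n + 3) (insert (n + 2) (insert (n + 1) (insert n {..<n})))"
    by auto
  have c: "real (n + 3 choose n) = (real n + 3) * (real n + 2) * (real n + 1) / 6"
  proof -
    have "fact (n + 3) = real (n + 3 choose n) * (fact n * fact 3)"
      using binomial_fact[of n "n + 3", where 'a = real] by (simp add: field_simps)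
    then have "((real n + 3) * (real n + 2) * (real n + 1)) * fact n = (real (n + 3 choose n) * 6) * fact n"
      by (simp add: fact_numeral numeral_3_eq_3 algebra_simps)
    then show ?thesis using fact_nonzero[of n, where 'a = real] by simp
  qed
  show "msinh x I w y (n + 1) = 2 * (real n + 1) * y * chi_moment x I w n"
    "msinh x I w y (n + 2) = 0"
    unfolding msinh_binomial S by (simp_all add: 0 assms(2)[simplified])
  show "msinh x I w y (n + 3) = 2 * (real n + 3) * y * chi_moment x I w (n + 2)
      + (real n + 3) * (real n + 2) * (real n + 1) / 3 * y ^ 3 * chi_moment x I w n"
    unfolding msinh_binomial S
    using binomial_symmetric[of "n + 2" "n + 3"]
    by (simp add: 0 assms(2)[simplified] c) (simp add: algebra_simps)
qed

text \<open>The minus sign arises because \<open>chi 3 = -1\<close> and \<open>chi (-3) = 1\<close>,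
  opposite to \<open>chi 1\<close> and \<open>chi (-1)\<close>.\<close>

lemma chi_moment_insert:
  assumes "finite I" "i \<notin> I"
  shows "chi_moment x (insert i I) (int (card (insert i I))) k = msinh x I (int (card I)) (x i) k"
    and "chi_moment x (insert i I) (int (card (insert i I)) + 8) k
      = msinh x I (int (card I) + 8) (x i) k - msinh x I (int (card I)) (3 * x i) k"
proof -
  note * = sum_shell_odds_insert[OF assms,
    where f = "\<lambda>a. (\<Prod>i\<in>insert i I. chi (a i)) * lin x (insert i I) a ^ k"]
  have P: "(\<Prod>j\<in>insert i I. chi ((a(i := c)) j)) = chi c * (\<Prod>j\<in>I. chi (a j))" for a c
    using assms by (subst prod.insert) (auto intro!: prod.cong)
  show "chi_moment x (insert i I) (int (card (insert i I))) k = msinh x I (int (card I)) (x i) k"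
    unfolding chi_moment_def * msinh_def
    by (simp only: lin_update[OF assms] P) (simp add: chi_def algebra_simps)
  show "chi_moment x (insert i I) (int (card (insert i I)) + 8) k
      = msinh x I (int (card I) + 8) (x i) k - msinh x I (int (card I)) (3 * x i) k"
    unfolding chi_moment_def * msinh_def
    by (simp only: lin_update[OF assms] P)
      (simp add: chi_def algebra_simps sum_subtractf sum.distrib sum_negf)
qed

text \<open>The generating function is the product of the \<open>2 sinh (x i * t)\<close>, which
  begins \<open>2^n P t^n (1 + s1 t^2 / 6 + ...)\<close>. For eight coordinates the character is
  therefore invisible to moments of degree below 8.\<close>

lemma chi_moment_0:
  fixes x :: "'i \<Rightarrow> real"
  assumes "finite I"
  defines "n \<equiv> card I" and "P \<equiv> \<Prod>i\<in>I. x i" and "s1 \<equiv> psum x I 1"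
  shows "(\<forall>m<n. chi_moment x I (int n) m = 0)
    \<and> chi_moment x I (int n) n = 2 ^ n * fact n * P
    \<and> chi_moment x I (int n) (n + 1) = 0
    \<and> chi_moment x I (int n) (n + 2) = 2 ^ n * fact (n + 2) * P * s1 / 6"
  using assms(1) unfolding assms(2-)
proof (induction I rule: finite_induct)
  case empty
  show ?case by (simp add: chi_moment_def shell_empty)
next
  case (insert i I)
  define N where "N = card I"
  have c: "card (insert i I) = N + 1" using insert.hyps by (simp add: N_def)
  note IH = insert.IH[folded N_def]
  note low = msinh_low[of N x I "int N", OF IH[THEN conjunct1, rule_format]
      IH[THEN conjunct2, THEN conjunct2, THEN conjunct1]]
  have e: "chi_moment x (insert i I) (int (N + 1)) k = msinh x I (int N) (x i) k" for k
    using chi_moment_insert(1)[OF insert.hyps] unfolding c N_def[symmetric] .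
  have "N + 1 + 1 = N + 2" "N + 1 + 2 = N + 3" by simp_all
  then show ?case
    unfolding c e psum_insert[OF insert.hyps] prod.insert[OF insert.hyps]
    using IH
    by (intro conjI, simp add: low(1))
      (simp_all only: low, simp_all add: numeral_3_eq_3 field_simps power2_eq_square power3_eq_cube)
qed

text \<open>Replacing one factor \<open>sinh u\<close> by \<open>- sinh (3 u)\<close> multiplies the
  product by \<open>-(3 + 4 u^2 + ...)\<close>. Summed over the position of the coordinate +-3 this
  gives \<open>-(3 n + 4 s1 t^2 + ...)\<close>, whose product with the series of
  \<open>chi_moment_0\<close> yields these coefficients.\<close>

lemma chi_moment_1:
  fixes x :: "'i \<Rightarrow> real"
  assumes "finite I"
  defines "n \<equiv> card I" and "P \<equiv> \<Prod>i\<in>I. x i" and "s1 \<equiv> psum x I 1"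
  shows "(\<forall>m<n. chi_moment x I (int n + 8) m = 0)
    \<and> chi_moment x I (int n + 8) n = - (3 * real n * 2 ^ n * fact n * P)
    \<and> chi_moment x I (int n + 8) (n + 1) = 0
    \<and> chi_moment x I (int n + 8) (n + 2) = - ((3 * real n + 24) * 2 ^ n * fact (n + 2) * P * s1 / 6)"
  using assms(1) unfolding assms(2-)
proof (induction I rule: finite_induct)
  case empty
  show ?case by (simp add: chi_moment_def shell_empty)
next
  case (insert i I)
  define N where "N = card I"
  have c: "card (insert i I) = N + 1" using insert.hyps by (simp add: N_def)
  note IH0 = chi_moment_0[OF insert.hyps(1), of x, folded N_def]
  note low0 = msinh_low[of N x I "int N", OF IH0[THEN conjunct1, rule_format]
      IH0[THEN conjunct2, THEN conjunct2, THEN conjunct1]]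
  note IH = insert.IH[folded N_def]
  note low = msinh_low[of N x I "int N + 8", OF IH[THEN conjunct1, rule_format]
      IH[THEN conjunct2, THEN conjunct2, THEN conjunct1]]
  have e: "chi_moment x (insert i I) (int (N + 1) + 8) k
      = msinh x I (int N + 8) (x i) k - msinh x I (int N) (3 * x i) k" for k
    using chi_moment_insert(2)[OF insert.hyps] unfolding c N_def[symmetric] .
  have "N + 1 + 1 = N + 2" "N + 1 + 2 = N + 3" by simp_all
  then show ?case
    unfolding c e psum_insert[OF insert.hyps] prod.insert[OF insert.hyps]
    using IH IH0
    by (intro conjI, simp add: low(1) low0(1))
      (simp_all only: low low0, simp_all add: numeral_3_eq_3 field_simps power2_eq_square power3_eq_cube)
qed

subsection \<open>Hermite interpolation by an even polynomial\<close>

text \<open>Rolle between consecutive zeros. The new zeros avoid \<open>Z\<close>, so that zeros of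
  the derivative at points of \<open>Z\<close> itself (double zeros of \<open>f\<close>) can later
  be counted in addition.\<close>

lemma rolle_zeros:
  fixes f f' :: "real \<Rightarrow> real"
  assumes "finite Z" "Z \<noteq> {}" "Z \<subseteq> {l<..<u}"
    and der: "\<And>t. t \<in> {l<..<u} \<Longrightarrow> (f has_real_derivative f' t) (at t)"
    and "\<And>z. z \<in> Z \<Longrightarrow> f z = 0"
  shows "\<exists>Z'. finite Z' \<and> Suc (card Z') = card Z \<and> Z' \<inter> Z = {} \<and> Z' \<subseteq> {Min Z<..<Max Z}
    \<and> (\<forall>z\<in>Z'. f' z = 0)"
  using assms(1-3,5)
proof (induction Z rule: finite_linorder_max_induct)
  case empty
  then show ?case by simp
next
  case (insert b Z)
  show ?case
  proof (cases "Z = {}")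
    case True
    then show ?thesis by (intro exI[of _ "{}"]) auto
  next
    case False
    with insert obtain Z' where Z': "finite Z'" "Suc (card Z') = card Z" "Z' \<inter> Z = {}"
      "Z' \<subseteq> {Min Z<..<Max Z}" "\<forall>z\<in>Z'. f' z = 0" by auto
    have M: "Max Z \<in> Z" "Max Z < b" "Min Z \<le> Max Z"
      using insert.hyps False by auto
    have sub: "{Max Z..b} \<subseteq> {l<..<u}"
    proof -
      have "Max Z \<in> {l<..<u}" "b \<in> {l<..<u}" using M insert.prems(2) by blast+
      then show ?thesis by auto
    qed
    \<comment> \<open>The new largest point \<open>b\<close> contributes one further zero, between
      the old maximum and \<open>b\<close>.\<close>
    have "\<exists>z. Max Z < z \<and> z < b \<and> f' z = 0"
    proof -
      have "f (Max Z) = f b" using M insert.prems(3) by simp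
      moreover have "continuous_on {Max Z..b} f"
        using der sub by (intro continuous_at_imp_continuous_on) (blast intro: DERIV_isCont)
      moreover have "f differentiable (at t)" if "Max Z < t" "t < b" for t
      proof -
        have "t \<in> {l<..<u}" using that by (intro subsetD[OF sub]) auto
        then show ?thesis using der unfolding real_differentiable_def by blast
      qed
      ultimately obtain z where z: "Max Z < z" "z < b" "(f has_real_derivative 0) (at z)"
        using Rolle[OF M(2)] by blast
      moreover have "z \<in> {l<..<u}" using z by (intro subsetD[OF sub]) auto
      ultimately show ?thesis using DERIV_unique[OF z(3) der] by auto
    qed
    then obtain z where z: "Max Z < z" "z < b" "f' z = 0" by blast
    have "z \<notin> Z" using z insert.hyps(1) Max_ge leD by blast
    moreover have "b \<notin> Z'" "z \<notin> Z'" using Z'(4) M z by auto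
    moreover have "Max (insert b Z) = b" using insert.hyps by (intro Max_insert2) auto
    moreover have "Min (insert b Z) = Min Z"
      using M by (simp only: Min_insert[OF insert.hyps(1) False] min_def) auto
    moreover have "b \<notin> Z" using insert.hyps by auto
    moreover have "Z' \<subseteq> {Min Z<..<b}" using Z'(4) M(2) by auto
    moreover have "Min Z < z" using M z by auto
    ultimately show ?thesis
      using Z' z insert.hyps(1) by (intro exI[of _ "insert z Z'"]) auto
  qed
qed

lemma rolle_iterated:
  fixes F :: "nat \<Rightarrow> real \<Rightarrow> real"
  assumes "finite Z" "Z \<subseteq> {l<..<u}" "k < card Z" "\<And>z. z \<in> Z \<Longrightarrow> F j z = 0"
    and "\<And>i t. i < j + k \<Longrightarrow> t \<in> {l<..<u} \<Longrightarrow> (F i has_real_derivative F (Suc i) t) (at t)"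
  shows "\<exists>z\<in>{l<..<u}. F (j + k) z = 0"
  using assms
proof (induction k arbitrary: j Z)
  case 0
  then have "Z \<noteq> {}" by auto
  then obtain z where "z \<in> Z" by blast
  then show ?case using 0 by (intro bexI[of _ z]) auto
next
  case (Suc k)
  then have "Z \<noteq> {}" by auto
  with Suc obtain Z' where Z': "finite Z'" "Suc (card Z') = card Z"
    "Z' \<subseteq> {Min Z<..<Max Z}" "\<forall>z\<in>Z'. F (Suc j) z = 0"
    using rolle_zeros[of Z l u "F j" "F (Suc j)"] by auto
  have "Min Z \<in> Z" "Max Z \<in> Z" using Suc.prems(1) \<open>Z \<noteq> {}\<close> by auto
  then have "{Min Z<..<Max Z} \<subseteq> {l<..<u}" using Suc.prems(2) by (auto simp: subset_iff)
  then have "Z' \<subseteq> {l<..<u}" using Z'(3) by blast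
  then show ?case using Suc.IH[of Z' "Suc j"] Z' Suc.prems by auto
qed

lemma poly_higher_pderiv_top:
  fixes p :: "real poly"
  assumes "degree p \<le> n"
  shows "poly ((pderiv ^^ n) p) x = fact n * coeff p n"
proof -
  have "(pderiv ^^ n) p = [:fact n * coeff p n:]"
  proof (rule poly_eqI)
    fix k
    show "coeff ((pderiv ^^ n) p) k = coeff [:fact n * coeff p n:] k"
      using assms by (cases k) (auto simp: coeff_higher_pderiv coeff_eq_0 pochhammer_fact[symmetric])
  qed
  then show ?thesis by simp
qed

text \<open>The difference \<open>G 0 - p\<close> vanishes on \<open>Z\<close>, doubly on
  \<open>Y\<close>. Its derivative has \<open>card Z - 1\<close> zeros from Rolle and
  \<open>card Y\<close> further ones, at least \<open>n\<close> in all, and each further derivative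
  costs one zero; so the \<open>n\<close>-th derivative still has a zero.\<close>

lemma hermite_mean_value:
  fixes G :: "nat \<Rightarrow> real \<Rightarrow> real" and p :: "real poly"
  assumes der: "\<And>i t. i < n \<Longrightarrow> t \<in> {l<..<u} \<Longrightarrow> (G i has_real_derivative G (Suc i) t) (at t)"
    and Z: "finite Z" "Z \<noteq> {}" "Z \<subseteq> {l<..<u}" "Y \<subseteq> Z"
    and "\<And>z. z \<in> Z \<Longrightarrow> G 0 z = poly p z"
    and "\<And>z. z \<in> Y \<Longrightarrow> G 1 z = poly (pderiv p) z"
    and "degree p \<le> n" "0 < n" "n < card Z + card Y"
  shows "\<exists>z\<in>{l<..<u}. G n z = fact n * coeff p n"
proof -
  define F where "F i t = G i t - poly ((pderiv ^^ i) p) t" for i t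
  have F: "(F i has_real_derivative F (Suc i) t) (at t)" if "i < n" "t \<in> {l<..<u}" for i t
    unfolding F_def using der[OF that] by (auto intro!: derivative_eq_intros poly_DERIV)
  have "F 0 z = 0" if "z \<in> Z" for z using that assms(6) by (simp add: F_def)
  then obtain Z' where Z': "finite Z'" "Suc (card Z') = card Z" "Z' \<inter> Z = {}"
      "Z' \<subseteq> {Min Z<..<Max Z}" "\<forall>z\<in>Z'. F 1 z = 0"
    using rolle_zeros[OF Z(1-3), of "F 0" "F 1"] F[of 0] \<open>0 < n\<close> by auto
  have "Min Z \<in> Z" "Max Z \<in> Z" using Z by auto
  then have "{Min Z<..<Max Z} \<subseteq> {l<..<u}" using Z(3) by (auto simp: subset_iff)
  then have sub: "Z' \<union> Y \<subseteq> {l<..<u}" using Z'(4) Z by blast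
  have fY: "finite Y" using Z finite_subset by blast
  have "card (Z' \<union> Y) = card Z' + card Y"
    using Z' Z fY by (intro card_Un_disjoint) auto
  then have "n - 1 < card (Z' \<union> Y)" using Z'(2) assms(10) \<open>0 < n\<close> by linarith
  moreover have "F 1 z = 0" if "z \<in> Z' \<union> Y" for z
    using that Z'(5) assms(7) by (auto simp: F_def)
  ultimately have "\<exists>z\<in>{l<..<u}. F (1 + (n - 1)) z = 0"
    using F Z'(1) fY sub \<open>0 < n\<close> by (intro rolle_iterated[of "Z' \<union> Y"]) auto
  then show ?thesis
    using \<open>0 < n\<close> poly_higher_pderiv_top[OF assms(8)] by (auto simp: F_def)
qed

text \<open>These are the numbers \<open>k / (2 * sqrt 2)\<close> with integer \<open>k\<close> and
  \<open>\<bar>k\<bar> \<le> 2\<close>, the possible inner products between the two codes.\<close>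

definition nodes :: "real set" where
  "nodes = {0, sqrt 2 / 4, - (sqrt 2 / 4), sqrt 2 / 2, - (sqrt 2 / 2)}"

lemma node_squares: "(sqrt 2 / 4)\<^sup>2 = 1 / 8" "(sqrt 2 / 2)\<^sup>2 = 1 / 2"
  by (simp_all add: power_divide)

lemma nodes_iff: "t \<in> nodes \<longleftrightarrow> t\<^sup>2 = 0 \<or> t\<^sup>2 = 1 / 8 \<or> t\<^sup>2 = 1 / 2"
proof -
  have "t\<^sup>2 = c\<^sup>2 \<longleftrightarrow> t = c \<or> t = - c" for c :: real by (rule power2_eq_iff)
  from this[of "sqrt 2 / 4"] this[of "sqrt 2 / 2"] show ?thesis
    unfolding nodes_def node_squares by auto
qed

lemma card_nodes: "card nodes = 5"
proof -
  have *: "card {0, s / 4, - (s / 4), s / 2, - (s / 2)} = 5" if "0 < s" for s :: real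
    using that by (simp add: card_insert_if)
  show ?thesis unfolding nodes_def by (rule *) simp
qed

lemma nodes_subset: "nodes \<subseteq> {-1<..<1}"
proof
  fix t assume "t \<in> nodes"
  then have "t\<^sup>2 < 1\<^sup>2" unfolding nodes_iff by auto
  then show "t \<in> {-1<..<1}" using abs_le_square_iff[of 1 t] by (auto simp: abs_less_iff)
qed

section \<open>The polynomial Pi of the overview and even Hermite interpolation at its zeros\<close>

definition node_poly :: "real poly" where
  "node_poly = [:0, 0, 1/256, 0, -5/64, 0, 33/64, 0, -5/4, 0, 1:]"

lemma poly_node_poly: "poly node_poly t = t\<^sup>2 * (t\<^sup>2 - 1/8)\<^sup>2 * (t\<^sup>2 - 1/2)\<^sup>2"
  unfolding node_poly_def by simp algebra

lemma poly_node_poly_nonneg: "0 \<le> poly node_poly t"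
  unfolding poly_node_poly by simp

lemma poly_node_poly_eq_0_iff: "poly node_poly t = 0 \<longleftrightarrow> t \<in> nodes"
  unfolding poly_node_poly nodes_iff by auto

lemma poly_pderiv_node_poly: "t \<in> nodes \<Longrightarrow> poly (pderiv node_poly) t = 0"
proof -
  assume "t \<in> nodes"
  moreover have "poly (pderiv node_poly) t
    = 2 * t * (t\<^sup>2 - 1/8) * (t\<^sup>2 - 1/2) * (5 * t^4 - 15/8 * t\<^sup>2 + 1/16)"
    unfolding node_poly_def by (simp add: pderiv_pCons) algebra
  ultimately show ?thesis unfolding nodes_iff by auto
qed

definition evenpoly :: "real \<Rightarrow> real \<Rightarrow> real \<Rightarrow> real \<Rightarrow> real \<Rightarrow> real poly" where
  "evenpoly a0 a2 a4 a6 a8 = [:a0, 0, a2, 0, a4, 0, a6, 0, a8:]"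

lemma poly_evenpoly:
  "poly (evenpoly a0 a2 a4 a6 a8) t = a0 + a2 * t^2 + a4 * t^4 + a6 * t^6 + a8 * t^8"
  unfolding evenpoly_def by simp algebra

lemma poly_pderiv_evenpoly:
  "poly (pderiv (evenpoly a0 a2 a4 a6 a8)) t
     = 2 * t * (a2 + 2 * a4 * t^2 + 3 * a6 * (t^2)^2 + 4 * a8 * (t^2)^3)"
  unfolding evenpoly_def by (simp add: pderiv_pCons) algebra

text \<open>In the variable \<open>t\<^sup>2\<close> there are five conditions, namely values at 0,
  1/8, 1/2 and slopes at 1/8, 1/2, for five coefficients. The slope at \<open>t = 0\<close> and the
  conditions at the negative nodes then follow from parity.\<close>

lemma even_hermite_exists:
  fixes g g' :: "real \<Rightarrow> real"
  assumes "\<And>t. t \<in> {-1<..<1} \<Longrightarrow> g (- t) = g t" and "\<And>t. t \<in> {-1<..<1} \<Longrightarrow> g' (- t) = - g' t"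
  obtains a0 a2 a4 a6 a8 where
    "\<And>t. t \<in> nodes \<Longrightarrow> g t = poly (evenpoly a0 a2 a4 a6 a8) t"
    "\<And>t. t \<in> nodes \<Longrightarrow> g' t = poly (pderiv (evenpoly a0 a2 a4 a6 a8)) t"
proof -
  define \<alpha> \<beta> where "\<alpha> = sqrt 2 / 4" and "\<beta> = sqrt 2 / 2"
  note sq = node_squares[folded \<alpha>_def \<beta>_def]
  have nz: "\<alpha> \<noteq> 0" "\<beta> \<noteq> 0" unfolding \<alpha>_def \<beta>_def by auto
  txt \<open>Newton's divided differences in the variable \<open>t\<^sup>2\<close> at \<open>0, 1/8, 1/8, 1/2, 1/2\<close>.\<close>
  define A where "A = 8 * (g \<alpha> - g 0)"
  \<comment> \<open>\<open>g' \<alpha> / (2 * \<alpha>)\<close> is the slope in the variable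
    \<open>t\<^sup>2\<close>; the factors 8 and 64/9 are the inverses of 1/8 and of the square of
    1/2 - 1/8.\<close>
  define B where "B = 8 * (g' \<alpha> / (2 * \<alpha>) - A)"
  define C where "C = 64/9 * (2 * (g \<beta> - g 0) - A - 3/8 * B)"
  define D where "D = 64/9 * (2 * (g' \<beta> / (2 * \<beta>) - 2 * (g \<beta> - g 0)) - B - 3/4 * C)"
  define p where "p = evenpoly (g 0) (A - B/8 + C/64 - D/128) (B - C/4 + 9/64 * D) (C - 3/4 * D) D"
  have poly_p: "poly p t = g 0 + t\<^sup>2 * (A + B * (t\<^sup>2 - 1/8) + C * (t\<^sup>2 - 1/8)\<^sup>2 + D * (t\<^sup>2 - 1/8)\<^sup>2 * (t\<^sup>2 - 1/2))" for t
    unfolding p_def poly_evenpoly by (simp add: eval_nat_numeral field_simps)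
  have e0: "poly p t = g 0" if "t = 0" for t unfolding poly_p that by simp
  have ea: "poly p t = g \<alpha>" if "t\<^sup>2 = 1/8" for t
    unfolding poly_p that by (simp add: A_def field_simps)
  have eb: "poly p t = g \<beta>" if "t\<^sup>2 = 1/2" for t
    unfolding poly_p that by (simp add: C_def power2_eq_square field_simps)
  have d0: "poly (pderiv p) t = 0" if "t = 0" for t
    unfolding p_def poly_pderiv_evenpoly that by simp
  have da: "poly (pderiv p) t = 2 * t * (g' \<alpha> / (2 * \<alpha>))" if "t\<^sup>2 = 1/8" for t
    unfolding p_def poly_pderiv_evenpoly that by (simp add: B_def power2_eq_square power3_eq_cube field_simps)
  have db: "poly (pderiv p) t = 2 * t * (g' \<beta> / (2 * \<beta>))" if "t\<^sup>2 = 1/2" for t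
    unfolding p_def poly_pderiv_evenpoly that by (simp add: D_def C_def power2_eq_square power3_eq_cube field_simps)
  have n: "\<alpha> \<in> {-1<..<1}" "\<beta> \<in> {-1<..<1}"
    using nodes_subset unfolding \<alpha>_def \<beta>_def nodes_def by auto
  have "g' 0 = 0" using assms(2)[of 0] by simp
  have cases: "t = 0 \<or> t = \<alpha> \<or> t = - \<alpha> \<or> t = \<beta> \<or> t = - \<beta>" if "t \<in> nodes" for t
    using that unfolding nodes_def \<alpha>_def \<beta>_def by simp
  have "g' t = poly (pderiv p) t" if "t \<in> nodes" for t
    using cases[OF that] assms(2)[OF n(1)] assms(2)[OF n(2)] \<open>g' 0 = 0\<close> nz
    by (elim disjE) (simp_all add: d0 da db sq)
  moreover have "g t = poly p t" if "t \<in> nodes" for t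
    using cases[OF that] assms(1)[OF n(1)] assms(1)[OF n(2)]
    by (elim disjE) (simp_all add: e0 ea eb sq)
  ultimately show ?thesis using that unfolding p_def by blast
qed

text \<open>Evenness lets degree 8 meet ten Hermite conditions. Since ten exceeds 8, the mean value
  lemma expresses \<open>a8\<close> as a value of \<open>G 8\<close> over \<open>fact 8\<close>. One
  more condition at a point off the nodes makes eleven, which exceeds 10 and gives the sign of the
  error through \<open>G 10\<close>.\<close>

lemma even_interpolant:
  fixes G :: "nat \<Rightarrow> real \<Rightarrow> real"
  assumes der: "\<And>i t. i < 10 \<Longrightarrow> t \<in> {-1<..<1} \<Longrightarrow> (G i has_real_derivative G (Suc i) t) (at t)"
    and "\<And>t. t \<in> {-1<..<1} \<Longrightarrow> G 0 (- t) = G 0 t" "\<And>t. t \<in> {-1<..<1} \<Longrightarrow> G 1 (- t) = - G 1 t"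
    and pos: "\<And>t. t \<in> {-1<..<1} \<Longrightarrow> 0 < G 8 t" "\<And>t. t \<in> {-1<..<1} \<Longrightarrow> 0 < G 10 t"
  obtains a0 a2 a4 a6 a8 where "0 < a8"
    "\<And>t. t \<in> nodes \<Longrightarrow> G 0 t = poly (evenpoly a0 a2 a4 a6 a8) t"
    "\<And>t. t \<in> {-1<..<1} \<Longrightarrow> poly (evenpoly a0 a2 a4 a6 a8) t \<le> G 0 t"
proof -
  obtain a0 a2 a4 a6 a8 where
    p: "\<And>t. t \<in> nodes \<Longrightarrow> G 0 t = poly (evenpoly a0 a2 a4 a6 a8) t"
      "\<And>t. t \<in> nodes \<Longrightarrow> G 1 t = poly (pderiv (evenpoly a0 a2 a4 a6 a8)) t"
    using even_hermite_exists[of "G 0" "G 1"] assms(2,3) by metis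
  define q where "q = evenpoly a0 a2 a4 a6 a8"
  note p = p[folded q_def]
  have fin: "finite nodes" "nodes \<noteq> {}" unfolding nodes_def by auto
  have "coeff q 8 = a8" "degree q \<le> 8"
    by (auto simp: q_def evenpoly_def numeral_eq_Suc)
  moreover have "\<exists>z\<in>{-1<..<1}. G 8 z = fact 8 * coeff q 8"
    using der fin nodes_subset p calculation(2) card_nodes
    by (intro hermite_mean_value[of 8 _ _ _ nodes nodes]) auto
  ultimately have "0 < fact 8 * a8" using pos(1) by metis
  then have a8: "0 < a8" by (simp add: zero_less_mult_iff)
  have "poly q t \<le> G 0 t" if t: "t \<in> {-1<..<1}" for t
  proof (cases "t \<in> nodes")
    case True
    then show ?thesis using p(1) by simp
  next
    case False
    \<comment> \<open>This \<open>c\<close> makes \<open>q + c * node_poly\<close> agree with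
      \<open>G 0\<close> at \<open>t\<close> too, without disturbing the double contact at the
      nodes; \<open>c\<close> is its coefficient of degree 10.\<close>
    define c where "c = (G 0 t - poly q t) / poly node_poly t"
    have pt: "0 < poly node_poly t"
      using False poly_node_poly_nonneg[of t] poly_node_poly_eq_0_iff[of t] by simp
    define r where "r = q + smult c node_poly"
    have r: "coeff r 10 = c" "degree r \<le> 10"
      by (auto simp: r_def q_def evenpoly_def node_poly_def numeral_eq_Suc)
    have "\<exists>z\<in>{-1<..<1}. G 10 z = fact 10 * coeff r 10"
    proof (rule hermite_mean_value[of 10 _ _ _ "insert t nodes" nodes])
      show "G 0 z = poly r z" if "z \<in> insert t nodes" for z
        using that p(1) pt poly_node_poly_eq_0_iff[of z] by (auto simp: r_def c_def)
      show "G 1 z = poly (pderiv r) z" if "z \<in> nodes" for z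
        using that p(2) poly_pderiv_node_poly by (simp add: r_def pderiv_add pderiv_smult)
    qed (use der fin nodes_subset t r False card_nodes in auto)
    then have "0 < fact 10 * c" using pos(2) r(1) by metis
    then have "0 < c" by (simp add: zero_less_mult_iff)
    then show ?thesis using pt by (simp add: c_def zero_less_divide_iff)
  qed
  then show ?thesis using that[OF a8] p(1) unfolding q_def by blast
qed

section \<open>Passing from the interpolant to an extended-real potential\<close>

lemma hderiv_has_derivative:
  assumes "times_differentiable n h" "i < n" "t \<in> {-1<..<1}"
  shows "(hderiv i h has_real_derivative hderiv (Suc i) h t) (at t)"
  using assms unfolding times_differentiable_def
  by (simp add: hderiv_def DERIV_deriv_iff_real_differentiable)

text \<open>The interpolation is applied to \<open>h t + h (- t)\<close>, whose derivatives of even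
  order are sums of two values of the same derivative of \<open>h\<close> and so inherit positivity
  in orders 8 and 10.\<close>

lemma potential_interpolant:
  assumes h: "potential h" "times_differentiable 10 h"
    and pos: "\<And>t. t \<in> {-1<..<1} \<Longrightarrow> 0 < hderiv 8 h t" "\<And>t. t \<in> {-1<..<1} \<Longrightarrow> 0 < hderiv 10 h t"
  obtains a0 a2 a4 a6 a8 where "0 < a8"
    "\<And>t. t \<in> nodes \<Longrightarrow>
      real_of_ereal (h t) + real_of_ereal (h (- t)) = poly (evenpoly a0 a2 a4 a6 a8) t"
    "\<And>t. t \<in> {-1..1} \<Longrightarrow> ereal (poly (evenpoly a0 a2 a4 a6 a8) t) \<le> h t + h (- t)"
proof -
  define G where "G i t = hderiv i h t + (-1) ^ i * hderiv i h (- t)" for i t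
  have der: "(G i has_real_derivative G (Suc i) t) (at t)" if "i < 10" "t \<in> {-1<..<1}" for i t
  proof -
    note d = hderiv_has_derivative[OF h(2) \<open>i < 10\<close>]
    have "((\<lambda>t. hderiv i h (- t)) has_real_derivative hderiv (Suc i) h (- t) * (-1)) (at t)"
      by (rule DERIV_chain2[OF d]) (use that in \<open>auto intro!: derivative_eq_intros\<close>)
    from DERIV_add[OF d[OF that(2)] DERIV_cmult[OF this, of "(-1) ^ i"]]
    show ?thesis unfolding G_def by (simp add: algebra_simps)
  qed
  have posG: "0 < G 8 t" "0 < G 10 t" if "t \<in> {-1<..<1}" for t
    using that pos[of t] pos[of "- t"] by (auto simp: G_def)
  have evG: "G 0 (- t) = G 0 t" "G 1 (- t) = - G 1 t" for t
    by (auto simp: G_def)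
  obtain a0 a2 a4 a6 a8 where a: "0 < a8"
    "\<And>t. t \<in> nodes \<Longrightarrow> G 0 t = poly (evenpoly a0 a2 a4 a6 a8) t"
    "\<And>t. t \<in> {-1<..<1} \<Longrightarrow> poly (evenpoly a0 a2 a4 a6 a8) t \<le> G 0 t"
    by (rule even_interpolant[of G]) (blast intro: der evG posG)+
  define q where "q = evenpoly a0 a2 a4 a6 a8"
  have G0: "G 0 t = real_of_ereal (h t) + real_of_ereal (h (- t))" for t
    by (simp add: G_def hderiv_def)
  have cont: "continuous_on {-1..1} h" and fin: "\<And>t. t \<in> {-1..<1} \<Longrightarrow> \<bar>h t\<bar> \<noteq> \<infinity>"
    and ninf: "h 1 \<noteq> -\<infinity>"
    using h(1) unfolding potential_def by auto
  have inner: "ereal (poly q t) \<le> h t + h (- t)" if "t \<in> {-1<..<1}" for t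
  proof -
    have "h t = ereal (real_of_ereal (h t))" "h (- t) = ereal (real_of_ereal (h (- t)))"
      using fin[of t] fin[of "- t"] that by (auto simp: ereal_real')
    then have "h t + h (- t) = ereal (G 0 t)" unfolding G0 by (metis plus_ereal.simps(1))
    then show ?thesis using a(3)[OF that] by (simp add: q_def)
  qed
  \<comment> \<open>The endpoints are reached by a limit, since \<open>h 1\<close> may be infinite.
    Addition is continuous here because \<open>h (-1)\<close> is finite and \<open>h 1\<close> is
    not minus infinity.\<close>
  have "((\<lambda>t. h t + h (- t)) \<longlongrightarrow> h 1 + h (- 1)) (at_left 1)"
  proof (rule tendsto_add_ereal_general)
    show "(h \<longlongrightarrow> h 1) (at_left 1)" using continuous_on_Icc_at_leftD[OF cont] by simp
    have "continuous_on {-1..1} (\<lambda>t. h (- t))"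
      by (rule continuous_on_compose2[OF cont]) (auto intro!: continuous_intros)
    from continuous_on_Icc_at_leftD[OF this]
    show "((\<lambda>t. h (- t)) \<longlongrightarrow> h (- 1)) (at_left 1)" by simp
  qed (use fin[of "-1"] ninf in auto)
  moreover have "((\<lambda>t. ereal (poly q t)) \<longlongrightarrow> ereal (poly q 1)) (at_left 1)"
    by (intro tendsto_intros)
  moreover have "eventually (\<lambda>t. ereal (poly q t) \<le> h t + h (- t)) (at_left 1)"
    using inner by (intro eventually_at_leftI[of "-1"]) auto
  ultimately have one: "ereal (poly q 1) \<le> h 1 + h (- 1)"
    by (intro tendsto_le[of "at_left (1::real)"]) auto
  have "ereal (poly q t) \<le> h t + h (- t)" if t: "t \<in> {-1..1}" for t
  proof -
    have e: "poly q (- 1) = poly q 1" by (simp add: q_def poly_evenpoly)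
    have "t \<in> {-1<..<1} \<or> t = 1 \<or> t = -1" using t by force
    then show ?thesis
      using inner one by (elim disjE) (simp_all add: e add.commute[of "h (- 1)"])
  qed
  then show ?thesis using a(1,2) unfolding q_def G0 by (intro that) auto
qed

subsection \<open>Polarization of an antipodal code with vanishing moments\<close>

abbreviation (input) zonal_moment :: "'a::euclidean_space set \<Rightarrow> 'a \<Rightarrow> nat \<Rightarrow> real" where
  "zonal_moment X x k \<equiv> \<Sum>y\<in>X. (x \<bullet> y) ^ k"

text \<open>The constants 1/8, 3/80 and 1/64 are the means of \<open>(x \<bullet> y)^k\<close> over
  the sphere in dimension 8 for \<open>k = 2, 4, 6\<close>. The constant \<open>c\<close> depends on
  the code.\<close>

locale polar_code =
  fixes X D :: "'a::euclidean_space set" and c :: real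
  assumes finite: "finite X" and sphere: "X \<subseteq> sphere 0 1"
    and antipodal: "\<And>y. y \<in> X \<Longrightarrow> - y \<in> X"
    and moment_2: "\<And>x. x \<in> sphere 0 1 \<Longrightarrow> zonal_moment X x 2 = real (card X) / 8"
    and moment_4: "\<And>x. x \<in> sphere 0 1 \<Longrightarrow> zonal_moment X x 4 = 3 * real (card X) / 80"
    and moment_6: "\<And>x. x \<in> sphere 0 1 \<Longrightarrow> zonal_moment X x 6 = real (card X) / 64"
    and moment_10: "\<And>x. x \<in> sphere 0 1 \<Longrightarrow> zonal_moment X x 10 = 15/8 * zonal_moment X x 8 + c"
    and dual: "D = {x \<in> sphere 0 1. \<forall>y\<in>X. x \<bullet> y \<in> nodes}" and dual_nonempty: "D \<noteq> {}"
begin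

lemma inner_range: "x \<in> sphere 0 1 \<Longrightarrow> y \<in> X \<Longrightarrow> x \<bullet> y \<in> {-1..1}"
  using sphere Cauchy_Schwarz_ineq2[of x y] by (auto simp: abs_le_iff)

lemma sum_reflect: "(\<Sum>y\<in>X. f (- (x \<bullet> y))) = (\<Sum>y\<in>X. f (x \<bullet> y))"
  by (rule sum.reindex_bij_witness[where i = uminus and j = uminus]) (auto dest: antipodal)

text \<open>Seen from \<open>D\<close> the squares of the inner products take only the values 0,
  1/8, 1/2, where an even \<open>g\<close> agrees with a quadratic in \<open>t\<^sup>2\<close>. The
  moments of degree 0, 2 and 4 thus determine the sum, with no counting of distances.\<close>

lemma sum_dual:
  assumes x: "x \<in> D" and even: "\<And>t. t \<in> nodes \<Longrightarrow> g (- t) = g t"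
  shows "(\<Sum>y\<in>X. g (x \<bullet> y))
    = real (card X) / 240 * (84 * g 0 + 128 * g (sqrt 2 / 4) + 28 * g (sqrt 2 / 2))"
proof -
  define u v where "u = g (sqrt 2 / 4) - g 0" and "v = g (sqrt 2 / 2) - g 0"
  \<comment> \<open>Solves \<open>a2 / 8 + a4 / 64 = u\<close> and
    \<open>a2 / 2 + a4 / 4 = v\<close>.\<close>
  define a4 where "a4 = 16/3 * (v - 4 * u)"
  define a2 where "a2 = 8 * u - a4 / 8"
  have g: "g t = g 0 + a2 * t^2 + a4 * t^4" if t: "t \<in> nodes" for t
  proof -
    have 4: "t^4 = (t\<^sup>2)\<^sup>2" by simp
    have m: "sqrt 2 / 4 \<in> nodes" "sqrt 2 / 2 \<in> nodes" by (auto simp: nodes_def)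
    consider "t = 0" | "t = sqrt 2 / 4 \<or> t = - (sqrt 2 / 4)" | "t = sqrt 2 / 2 \<or> t = - (sqrt 2 / 2)"
      using t unfolding nodes_def by blast
    then show ?thesis
    proof cases
      case 2
      then have "t\<^sup>2 = 1 / 8" "g t = g (sqrt 2 / 4)"
        by (elim disjE; simp only: power2_minus node_squares even[OF m(1)])+
      moreover have "g (sqrt 2 / 4) = g 0 + a2 * (1 / 8) + a4 * (1 / 8)\<^sup>2"
        by (simp add: a2_def a4_def u_def power2_eq_square field_simps)
      ultimately show ?thesis by (simp only: 4)
    next
      case 3
      then have "t\<^sup>2 = 1 / 2" "g t = g (sqrt 2 / 2)"
        by (elim disjE; simp only: power2_minus node_squares even[OF m(2)])+
      moreover have "g (sqrt 2 / 2) = g 0 + a2 * (1 / 2) + a4 * (1 / 2)\<^sup>2"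
        by (simp add: a2_def a4_def u_def v_def power2_eq_square field_simps)
      ultimately show ?thesis by (simp only: 4)
    qed simp
  qed
  have xs: "x \<in> sphere 0 1" using x dual by auto
  have "(\<Sum>y\<in>X. g (x \<bullet> y)) = (\<Sum>y\<in>X. g 0 + a2 * (x \<bullet> y)^2 + a4 * (x \<bullet> y)^4)"
    using x dual g by (intro sum.cong) auto
  also have "\<dots> = real (card X) * g 0 + a2 * zonal_moment X x 2 + a4 * zonal_moment X x 4"
    by (simp add: sum.distrib sum_distrib_left)
  finally show ?thesis
    unfolding moment_2[OF xs] moment_4[OF xs]
    by (simp add: a2_def a4_def u_def v_def field_simps)
qed

definition min_moment_8 :: real where
  "min_moment_8 = real (card X) / 240 * (128 / 8^4 + 28 / 2^4)"

lemma moment_8_dual: "x \<in> D \<Longrightarrow> zonal_moment X x 8 = min_moment_8"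
proof -
  have "(sqrt 2 / 4) ^ 8 = ((sqrt 2 / 4)\<^sup>2) ^ 4" "(sqrt 2 / 2) ^ 8 = ((sqrt 2 / 2)\<^sup>2) ^ 4"
    by (simp_all only: power_mult[symmetric]) simp_all
  then show "x \<in> D \<Longrightarrow> zonal_moment X x 8 = min_moment_8"
    using sum_dual[of x "\<lambda>t. t ^ 8"] unfolding min_moment_8_def node_squares
    by (simp add: power_divide)
qed

text \<open>The factor is 15/8 - 5/4. The additive constant is found by evaluating at a point of
  \<open>D\<close>, where every summand vanishes.\<close>

lemma moment_8_node_poly:
  assumes "x \<in> sphere 0 1"
  shows "(\<Sum>y\<in>X. poly node_poly (x \<bullet> y)) = 5/8 * (zonal_moment X x 8 - min_moment_8)"
proof -
  have *: "(\<Sum>y\<in>X. poly node_poly (x \<bullet> y)) = 5/8 * zonal_moment X x 8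
    + (c + 33/64 * (real (card X) / 64) - 5/64 * (3 * real (card X) / 80) + real (card X) / 8 / 256)"
    if x: "x \<in> sphere 0 1" for x
  proof -
    have "poly node_poly t = t^10 - 5/4 * t^8 + 33/64 * t^6 - 5/64 * t^4 + t^2 / 256" for t
      unfolding node_poly_def by (simp add: eval_nat_numeral field_simps)
    then have "(\<Sum>y\<in>X. poly node_poly (x \<bullet> y)) = zonal_moment X x 10 - 5/4 * zonal_moment X x 8
      + 33/64 * zonal_moment X x 6 - 5/64 * zonal_moment X x 4 + zonal_moment X x 2 / 256"
      by (simp add: sum.distrib sum_subtractf sum_distrib_left sum_divide_distrib)
    then show ?thesis
      unfolding moment_2[OF x] moment_4[OF x] moment_6[OF x] moment_10[OF x] by simp
  qed
  obtain d where d: "d \<in> D" using dual_nonempty by blast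
  then have "(\<Sum>y\<in>X. poly node_poly (d \<bullet> y)) = 0"
    using dual poly_node_poly_eq_0_iff by (intro sum.neutral) auto
  then show ?thesis using *[of d] *[OF assms] moment_8_dual[OF d] d dual by auto
qed

lemma moment_8_ge: "x \<in> sphere 0 1 \<Longrightarrow> min_moment_8 \<le> zonal_moment X x 8"
  using moment_8_node_poly[of x] sum_nonneg[of X "\<lambda>y. poly node_poly (x \<bullet> y)"]
    poly_node_poly_nonneg by auto

lemma moment_8_eq_iff: "x \<in> sphere 0 1 \<Longrightarrow> zonal_moment X x 8 = min_moment_8 \<longleftrightarrow> x \<in> D"
  using moment_8_node_poly[of x] sum_nonneg_eq_0_iff[OF finite, of "\<lambda>y. poly node_poly (x \<bullet> y)"]
    poly_node_poly_nonneg poly_node_poly_eq_0_iff dual by auto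

definition dual_value :: "(real \<Rightarrow> ereal) \<Rightarrow> real" where
  "dual_value h = (let H = (\<lambda>t. real_of_ereal (h t)) in real (card X) / 240 *
     (14 * H (- (sqrt 2 / 2)) + 64 * H (- (sqrt 2 / 4)) + 84 * H 0
       + 64 * H (sqrt 2 / 4) + 14 * H (sqrt 2 / 2)))"

text \<open>By antipodality twice the potential is the sum of \<open>h t + h (- t)\<close>, which
  dominates the sum of the interpolant, a constant plus \<open>a8\<close> times the eighth moment.
  Contact at the nodes identifies the constant on \<open>D\<close>; halving gives
  \<open>a = a8 / 2\<close>.\<close>

lemma U_bounds:
  assumes h: "potential h" "times_differentiable 10 h"
    and pos: "\<And>t. t \<in> {-1<..<1} \<Longrightarrow> 0 < hderiv 8 h t" "\<And>t. t \<in> {-1<..<1} \<Longrightarrow> 0 < hderiv 10 h t"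
  obtains a where "0 < a" "\<And>x. x \<in> D \<Longrightarrow> U h x X = ereal (dual_value h)"
    "\<And>x. x \<in> sphere 0 1 \<Longrightarrow>
      ereal (dual_value h + a * (zonal_moment X x 8 - min_moment_8)) \<le> U h x X"
proof -
  define H where "H t = real_of_ereal (h t)" for t
  obtain a0 a2 a4 a6 a8 where a: "0 < a8"
    "\<And>t. t \<in> nodes \<Longrightarrow> H t + H (- t) = poly (evenpoly a0 a2 a4 a6 a8) t"
    "\<And>t. t \<in> {-1..1} \<Longrightarrow> ereal (poly (evenpoly a0 a2 a4 a6 a8) t) \<le> h t + h (- t)"
    using potential_interpolant[OF h pos] unfolding H_def by metis
  define q where "q = poly (evenpoly a0 a2 a4 a6 a8)"
  note a = a[folded q_def]
  have H: "h t = ereal (H t)" if "t \<in> nodes" for t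
    using that nodes_subset h(1) unfolding potential_def H_def
    by (intro ereal_real'[symmetric]) force
  have dual_sum: "(\<Sum>y\<in>X. H (x \<bullet> y) + H (- (x \<bullet> y))) = 2 * dual_value h" if "x \<in> D" for x
    using sum_dual[OF that, of "\<lambda>t. H t + H (- t)"]
    by (simp add: dual_value_def H_def Let_def algebra_simps)
  have val: "U h x X = ereal (dual_value h)" if "x \<in> D" for x
  proof -
    have "U h x X = ereal (\<Sum>y\<in>X. H (x \<bullet> y))"
      unfolding U_def sum_ereal[symmetric] using that dual H by (intro sum.cong) auto
    moreover have "(\<Sum>y\<in>X. H (x \<bullet> y)) = dual_value h"
      using dual_sum[OF that] sum_reflect[of H x] by (simp add: sum.distrib)
    ultimately show ?thesis by simp
  qed
  have q_sum: "(\<Sum>y\<in>X. q (x \<bullet> y)) = (a0 * card X + a2 * (real (card X) / 8)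
      + a4 * (3 * real (card X) / 80) + a6 * (real (card X) / 64)) + a8 * zonal_moment X x 8"
    if x: "x \<in> sphere 0 1" for x
    unfolding moment_2[OF x, symmetric] moment_4[OF x, symmetric] moment_6[OF x, symmetric]
    by (simp add: q_def poly_evenpoly sum.distrib sum_distrib_left)
  obtain d where d: "d \<in> D" using dual_nonempty by blast
  have "(\<Sum>y\<in>X. q (d \<bullet> y)) = 2 * dual_value h"
    unfolding dual_sum[OF d, symmetric] using d dual a(2) by (intro sum.cong) auto
  then have q_sum': "(\<Sum>y\<in>X. q (x \<bullet> y)) = 2 * dual_value h + a8 * (zonal_moment X x 8 - min_moment_8)"
    if "x \<in> sphere 0 1" for x
    using q_sum[OF that] q_sum[of d] d dual moment_8_dual[OF d] by (simp add: algebra_simps)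
  have "ereal (dual_value h + a8 / 2 * (zonal_moment X x 8 - min_moment_8)) \<le> U h x X"
    if x: "x \<in> sphere 0 1" for x
  proof -
    have "ereal (\<Sum>y\<in>X. q (x \<bullet> y)) \<le> (\<Sum>y\<in>X. h (x \<bullet> y) + h (- (x \<bullet> y)))"
      unfolding sum_ereal[symmetric] using a(3) inner_range[OF x] by (intro sum_mono) auto
    also have "\<dots> = U h x X + U h x X"
      unfolding U_def sum.distrib sum_reflect ..
    finally show ?thesis
      unfolding q_sum'[OF x] by (cases "U h x X") (auto simp: field_simps)
  qed
  then show ?thesis using that[of "a8 / 2"] a(1) val by simp
qed

lemma polarization_eq:
  assumes "potential h" "times_differentiable 10 h"
    and "\<And>t. t \<in> {-1<..<1} \<Longrightarrow> 0 < hderiv 8 h t" "\<And>t. t \<in> {-1<..<1} \<Longrightarrow> 0 < hderiv 10 h t"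
  shows "polarization h X = ereal (dual_value h)" and "minimizers h X = D"
proof -
  obtain a where a: "0 < a" "\<And>x. x \<in> D \<Longrightarrow> U h x X = ereal (dual_value h)"
    "\<And>x. x \<in> sphere 0 1 \<Longrightarrow>
      ereal (dual_value h + a * (zonal_moment X x 8 - min_moment_8)) \<le> U h x X"
    using U_bounds[OF assms] by metis
  have le: "ereal (dual_value h) \<le> U h x X" if "x \<in> sphere 0 1" for x
    using order_trans[OF _ a(3)[OF that]] moment_8_ge[OF that] a(1) by simp
  obtain d where d: "d \<in> D" "d \<in> sphere 0 1" using dual_nonempty dual by blast
  show "polarization h X = ereal (dual_value h)"
    unfolding polarization_def
  proof (rule Least_equality)
    show "ereal (dual_value h) \<in> (\<lambda>x. U h x X) ` sphere 0 1"
      using d a(2) by (intro image_eqI[of _ _ d]) auto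
  qed (use le in auto)
  show "minimizers h X = D"
  proof (intro equalityI subsetI)
    fix x assume "x \<in> minimizers h X"
    then have x: "x \<in> sphere 0 1" "U h x X \<le> ereal (dual_value h)"
      using d a(2) unfolding minimizers_def by force+
    \<comment> \<open>Comparison with a point of \<open>D\<close> forces the eighth moment of any
      minimizer down to its minimum.\<close>
    then have "a * (zonal_moment X x 8 - min_moment_8) \<le> 0"
      using order_trans[OF a(3) x(2)] by simp
    then have "zonal_moment X x 8 \<le> min_moment_8"
      using a(1) by (simp add: mult_le_0_iff)
    then show "x \<in> D" using moment_8_ge moment_8_eq_iff x(1) by force
  next
    fix x assume "x \<in> D"
    then show "x \<in> minimizers h X" using a(2) le dual unfolding minimizers_def by auto
  qed
qed

end

subsection \<open>Moments of the shells of the lattice\<close>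

definition intvec :: "(8 \<Rightarrow> int) \<Rightarrow> real^8" where
  "intvec a = (\<chi> i. real_of_int (a i))"

definition halfvec :: "(8 \<Rightarrow> int) \<Rightarrow> real^8" where
  "halfvec a = (\<chi> i. real_of_int (a i) / 2)"

text \<open>Half-integral vectors are recorded by their odd numerators; the coordinate sum is even
  iff the numerators add up to a multiple of 4.\<close>

lemma E8_eq:
  "E8 = intvec ` {a. even (\<Sum>i\<in>UNIV. a i)} \<union> halfvec ` {a. (\<forall>i. odd (a i)) \<and> 4 dvd (\<Sum>i\<in>UNIV. a i)}"
proof (intro equalityI subsetI)
  fix x assume "x \<in> E8"
  then obtain k :: int where k: "(\<Sum>i\<in>UNIV. x $ i) = 2 * of_int k"
    and "(\<forall>i. x $ i \<in> \<int>) \<or> (\<forall>i. x $ i - 1/2 \<in> \<int>)" unfolding E8_def by auto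
  then consider "\<forall>i. x $ i \<in> \<int>" | "\<forall>i. x $ i - 1/2 \<in> \<int>" by blast
  then show "x \<in> intvec ` {a. even (\<Sum>i\<in>UNIV. a i)}
      \<union> halfvec ` {a. (\<forall>i. odd (a i)) \<and> 4 dvd (\<Sum>i\<in>UNIV. a i)}"
  proof cases
    case 1
    then have "\<forall>i. \<exists>a. x $ i = of_int a" by (auto elim: Ints_cases)
    then obtain a where a: "\<And>i. x $ i = of_int (a i)" by metis
    have "real_of_int (\<Sum>i\<in>UNIV. a i) = of_int (2 * k)" using k a by simp
    then have "even (\<Sum>i\<in>UNIV. a i)" unfolding of_int_eq_iff by simp
    moreover have "x = intvec a" by (simp add: vec_eq_iff intvec_def a)
    ultimately show ?thesis by blast
  next
    case 2
    then have "\<forall>i. \<exists>b. x $ i - 1/2 = of_int b" by (meson Ints_cases)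
    then obtain b where b: "\<And>i. x $ i - 1/2 = of_int (b i)" by metis
    define a where "a i = 2 * b i + 1" for i
    have a: "x $ i = of_int (a i) / 2" for i using b[of i] by (simp add: a_def field_simps)
    have "real_of_int (\<Sum>i\<in>UNIV. a i) = of_int (4 * k)"
      using k by (simp add: a sum_divide_distrib[symmetric])
    then have "4 dvd (\<Sum>i\<in>UNIV. a i)" unfolding of_int_eq_iff by simp
    moreover have "x = halfvec a" by (simp add: vec_eq_iff halfvec_def a)
    moreover have "\<forall>i. odd (a i)" by (simp add: a_def)
    ultimately show ?thesis by blast
  qed
next
  fix x assume "x \<in> intvec ` {a. even (\<Sum>i\<in>UNIV. a i)}
      \<union> halfvec ` {a. (\<forall>i. odd (a i)) \<and> 4 dvd (\<Sum>i\<in>UNIV. a i)}"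
  then consider a where "x = intvec a" "even (\<Sum>i\<in>UNIV. a i)"
    | a where "x = halfvec a" "\<And>i. odd (a i)" "4 dvd (\<Sum>i\<in>UNIV. a i)" by blast
  then show "x \<in> E8"
  proof cases
    case 1
    then obtain k where "(\<Sum>i\<in>UNIV. a i) = 2 * k" by (elim dvdE)
    then have "(\<Sum>i\<in>UNIV. x $ i) = 2 * of_int k"
      unfolding 1(1) intvec_def by (simp flip: of_int_sum)
    then show ?thesis unfolding E8_def 1(1) intvec_def by auto
  next
    case 2
    obtain k where "(\<Sum>i\<in>UNIV. a i) = 4 * k" using 2(3) by (elim dvdE)
    then have "(\<Sum>i\<in>UNIV. x $ i) = 2 * of_int k"
      unfolding 2(1) halfvec_def by (simp flip: of_int_sum sum_divide_distrib)
    moreover have "x $ i - 1/2 \<in> \<int>" for i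
    proof -
      obtain b where "a i = 2 * b + 1" using 2(2)[of i] by (elim oddE)
      then have "x $ i - 1/2 = of_int b" by (simp add: 2(1) halfvec_def field_simps)
      then show ?thesis by simp
    qed
    ultimately show ?thesis unfolding E8_def by auto
  qed
qed

lemma inner_intvec: "x \<bullet> intvec a = lin (($) x) UNIV a"
  and inner_halfvec: "x \<bullet> halfvec a = lin (($) x) UNIV a / 2"
  unfolding intvec_def halfvec_def inner_vec_def by (simp_all add: sum_divide_distrib mult.commute)

lemma norm_intvec: "(norm (intvec a))\<^sup>2 = of_int (\<Sum>i\<in>UNIV. (a i)\<^sup>2)"
  and norm_halfvec: "(norm (halfvec a))\<^sup>2 = of_int (\<Sum>i\<in>UNIV. (a i)\<^sup>2) / 4"
  unfolding power2_norm_eq_inner intvec_def halfvec_def inner_vec_def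
  by (simp_all add: power2_eq_square sum_divide_distrib)

text \<open>An odd \<open>a i\<close> is congruent to 1 or 3 modulo 4. Each coordinate of the second
  kind flips the product and shifts the sum of the \<open>a i - 1\<close> by 2 modulo 4.\<close>

lemma chi_prod_cases:
  assumes "finite I" "\<forall>i\<in>I. odd (a i)"
  shows "(\<Prod>i\<in>I. chi (a i)) = 1 \<and> 4 dvd ((\<Sum>i\<in>I. a i) - int (card I))
    \<or> (\<Prod>i\<in>I. chi (a i)) = -1 \<and> 4 dvd ((\<Sum>i\<in>I. a i) - int (card I) - 2)"
  using assms
proof (induction I rule: finite_induct)
  case (insert i I)
  have "odd (a i)" using insert.prems by simp
  then have "a i mod 4 = 1 \<and> 4 dvd (a i - 1) \<or> a i mod 4 \<noteq> 1 \<and> 4 dvd (a i - 3)" by presburger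
  then have c: "chi (a i) = 1 \<and> 4 dvd (a i - 1) \<or> chi (a i) = -1 \<and> 4 dvd (a i - 1 - 2)"
    by (auto simp: chi_def)
  have s: "(\<Sum>j\<in>insert i I. a j) - int (card (insert i I)) = (a i - 1) + ((\<Sum>j\<in>I. a j) - int (card I))"
    and p: "(\<Prod>j\<in>insert i I. chi (a j)) = chi (a i) * (\<Prod>j\<in>I. chi (a j))"
    using insert.hyps by simp_all
  have d: "4 dvd u \<Longrightarrow> 4 dvd v \<Longrightarrow> 4 dvd u + v"
    "4 dvd u \<Longrightarrow> 4 dvd v - 2 \<Longrightarrow> 4 dvd u + v - 2"
    "4 dvd u - 2 \<Longrightarrow> 4 dvd v \<Longrightarrow> 4 dvd u + v - 2"
    "4 dvd u - 2 \<Longrightarrow> 4 dvd v - 2 \<Longrightarrow> 4 dvd u + v" for u v :: int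
    by presburger+
  have "(\<Prod>j\<in>I. chi (a j)) = 1 \<and> 4 dvd ((\<Sum>j\<in>I. a j) - int (card I))
    \<or> (\<Prod>j\<in>I. chi (a j)) = -1 \<and> 4 dvd ((\<Sum>j\<in>I. a j) - int (card I) - 2)"
    using insert by simp
  with c show ?case
    unfolding s p by (elim disjE conjE) (simp_all only: d mult_1_left mult_1_right minus_mult_minus mult_minus1 mult_minus_left minus_minus simp_thms)
qed simp

lemma chi_prod_UNIV:
  fixes a :: "8 \<Rightarrow> int"
  assumes "\<forall>i. odd (a i)"
  shows "(1 + (\<Prod>i\<in>UNIV. chi (a i))) / 2 = (if 4 dvd (\<Sum>i\<in>UNIV. a i) then 1 else 0)"
proof -
  have "4 dvd (s - 8) \<longleftrightarrow> 4 dvd s" "4 dvd s \<Longrightarrow> \<not> 4 dvd (s - 8 - 2)" for s :: int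
    by presburger+
  then show ?thesis using chi_prod_cases[of UNIV a] assms by auto
qed

text \<open>Since \<open>a i\<close> and its square have the same parity, an even squared norm
  already makes the coordinate sum of an integral vector even.\<close>

lemma E8_shell_eq:
  assumes "even w"
  shows "{v \<in> E8. (norm v)\<^sup>2 = of_int w} = intvec ` shell UNIV UNIV w
    \<union> halfvec ` {a \<in> shell odds UNIV (4 * w). 4 dvd (\<Sum>i\<in>UNIV. a i)}"
proof -
  have "even (\<Sum>i\<in>UNIV. a i) \<longleftrightarrow> even (\<Sum>i\<in>UNIV. (a i)\<^sup>2)" for a :: "8 \<Rightarrow> int"
  proof -
    have "even (\<Sum>i\<in>UNIV. (a i)\<^sup>2 - a i)"
      by (intro dvd_sum) (simp add: power2_eq_square)
    then show ?thesis by (simp add: sum_subtractf)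
  qed
  moreover have "(real_of_int k / 4 = of_int w) \<longleftrightarrow> k = 4 * w" for k
    by (simp add: field_simps flip: of_int_mult) linarith
  ultimately show ?thesis
    using assms unfolding E8_eq shell_def odds_def
    by (auto simp: norm_intvec norm_halfvec simp del: of_int_sum)
qed

text \<open>The weight \<open>(1 + product of chi) / 2\<close> is the indicator of the condition
  modulo 4. It lets the sum run over all odd vectors and split into a plain and a twisted
  moment.\<close>

lemma sum_E8_shell:
  fixes f :: "real^8 \<Rightarrow> real"
  assumes "even w"
  shows "finite {v \<in> E8. (norm v)\<^sup>2 = of_int w}" (is "finite ?S")
    and "(\<Sum>v\<in>{v \<in> E8. (norm v)\<^sup>2 = of_int w}. f v) = (\<Sum>a\<in>shell UNIV UNIV w. f (intvec a))
      + (\<Sum>a\<in>shell odds UNIV (4 * w). (1 + (\<Prod>i\<in>UNIV. chi (a i))) / 2 * f (halfvec a))"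
proof -
  let ?H = "{a \<in> shell odds UNIV (4 * w). 4 dvd (\<Sum>i\<in>UNIV. a i)} :: (8 \<Rightarrow> int) set"
  have inj: "inj intvec" "inj halfvec"
    by (auto intro!: injI simp: intvec_def halfvec_def vec_eq_iff)
  have disj: "intvec ` shell UNIV UNIV w \<inter> halfvec ` ?H = {}"
  proof -
    have "intvec a \<noteq> halfvec b" if "odd (b i)" for a b i
    proof
      assume "intvec a = halfvec b"
      then have "real_of_int (2 * a i) = of_int (b i)"
        by (simp add: intvec_def halfvec_def vec_eq_iff field_simps)
      then show False using that unfolding of_int_eq_iff by (metis dvd_triv_left)
    qed
    then show ?thesis unfolding shell_def odds_def by fastforce
  qed
  have fin: "finite (shell UNIV UNIV w :: (8 \<Rightarrow> int) set)" by (simp add: finite_shell)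
  have "finite (shell odds UNIV (4 * w) :: (8 \<Rightarrow> int) set)" by (simp add: finite_shell)
  then have fin_H: "finite ?H" by simp
  show "finite ?S" unfolding E8_shell_eq[OF assms] using fin fin_H by auto
  have "(\<Sum>v\<in>?S. f v) = (\<Sum>a\<in>shell UNIV UNIV w. f (intvec a)) + (\<Sum>a\<in>?H. f (halfvec a))"
    unfolding E8_shell_eq[OF assms] using fin fin_H disj inj
    by (simp add: sum.union_disjoint sum.reindex inj_on_subset[OF _ subset_UNIV])
  also have "(\<Sum>a\<in>?H. f (halfvec a))
    = (\<Sum>a\<in>shell odds UNIV (4 * w). if 4 dvd (\<Sum>i\<in>UNIV. a i) then f (halfvec a) else 0)"
    by (rule sum.inter_filter) (auto intro: finite_shell)
  also have "\<dots> = (\<Sum>a\<in>shell odds UNIV (4 * w). (1 + (\<Prod>i\<in>UNIV. chi (a i))) / 2 * f (halfvec a))"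
  proof (rule sum.cong)
    fix a :: "8 \<Rightarrow> int" assume "a \<in> shell odds UNIV (4 * w)"
    then have "\<forall>i. odd (a i)" by (auto simp: shell_def odds_def)
    from chi_prod_UNIV[OF this]
    show "(if 4 dvd (\<Sum>i\<in>UNIV. a i) then f (halfvec a) else 0)
      = (1 + (\<Prod>i\<in>UNIV. chi (a i))) / 2 * f (halfvec a)" by simp
  qed simp
  finally show "(\<Sum>v\<in>?S. f v) = (\<Sum>a\<in>shell UNIV UNIV w. f (intvec a))
      + (\<Sum>a\<in>shell odds UNIV (4 * w). (1 + (\<Prod>i\<in>UNIV. chi (a i))) / 2 * f (halfvec a))" .
qed

lemma E8_moment:
  assumes "even w"
  shows "(\<Sum>v\<in>{v \<in> E8. (norm v)\<^sup>2 = of_int w}. (x \<bullet> v) ^ k) = moment UNIV (($) x) UNIV w k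
    + (moment odds (($) x) UNIV (4 * w) k + chi_moment (($) x) UNIV (4 * w) k) / (2 * 2 ^ k)"
proof -
  have "(1 + p) / 2 * (l / 2) ^ k = (l ^ k + p * l ^ k) / (2 * 2 ^ k)" for p l :: real
    by (simp add: power_divide field_simps)
  then show ?thesis
    unfolding sum_E8_shell(2)[OF assms] inner_intvec inner_halfvec moment_def chi_moment_def
    by (simp only: sum.distrib sum_divide_distrib[symmetric])
qed

lemma psum_1_sphere: "x \<in> sphere (0 :: real^8) 1 \<Longrightarrow> psum (($) x) UNIV 1 = 1"
  by (simp add: norm_eq_1 inner_vec_def power2_eq_square)

text \<open>Doubled half-integral roots lie on the lowest odd level 8. With eight coordinates and
  \<open>s1 = 1\<close>, the higher power sums cancel up to degree 6, and in degree 10 they and the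
  coordinate product occur in the same combination as in degree 8.\<close>

lemma E8_moments_2:
  fixes x :: "real^8"
  assumes "x \<in> sphere 0 1"
  defines "M k \<equiv> \<Sum>v\<in>{v \<in> E8. (norm v)\<^sup>2 = 2}. (x \<bullet> v) ^ k"
  shows "M 0 = 240" "M 2 = 60" "M 4 = 36" "M 6 = 30" "M 10 = 15/4 * M 8 - 315/4"
proof -
  have n: "card (UNIV :: 8 set) = 8" by simp
  have arith: "int 8 = 8" "(8::int) + 8 = 16" "(8::nat) + 2 = 10" by simp_all
  have s1: "(\<Sum>i\<in>UNIV. (x $ i)\<^sup>2) = 1" using psum_1_sphere[OF assms(1)] by simp
  have M: "M k = moment UNIV (($) x) UNIV 2 k
      + (moment odds (($) x) UNIV 8 k + chi_moment (($) x) UNIV 8 k) / (2 * 2 ^ k)" for k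
    using E8_moment[of 2 x k] by (simp add: M_def)
  note moments = moment_int_2[of "UNIV :: 8 set" "($) x", OF finite, unfolded n arith]
    moment_odd_0[of "UNIV :: 8 set" "($) x", OF finite, unfolded n arith]
    chi_moment_0[of "UNIV :: 8 set" "($) x", OF finite, unfolded n arith]
  show "M 0 = 240" "M 2 = 60" "M 4 = 36" "M 6 = 30" "M 10 = 15/4 * M 8 - 315/4"
    unfolding M by (simp add: moments s1 fact_numeral; simp add: field_simps)+
qed

text \<open>The same cancellation one level higher: integral vectors of squared norm 4 and odd
  vectors on the second level 16.\<close>

lemma E8_moments_4:
  fixes x :: "real^8"
  assumes "x \<in> sphere 0 1"
  defines "M k \<equiv> \<Sum>v\<in>{v \<in> E8. (norm v)\<^sup>2 = 4}. (x \<bullet> v) ^ k"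
  shows "M 0 = 2160" "M 2 = 1080" "M 4 = 1296" "M 6 = 2160" "M 10 = 15/2 * M 8 - 22680"
proof -
  have n: "card (UNIV :: 8 set) = 8" by simp
  have arith: "int 8 = 8" "(8::int) + 8 = 16" "(8::nat) + 2 = 10" by simp_all
  have s1: "(\<Sum>i\<in>UNIV. (x $ i)\<^sup>2) = 1" using psum_1_sphere[OF assms(1)] by simp
  have M: "M k = moment UNIV (($) x) UNIV 4 k
      + (moment odds (($) x) UNIV 16 k + chi_moment (($) x) UNIV 16 k) / (2 * 2 ^ k)" for k
    using E8_moment[of 4 x k] by (simp add: M_def)
  note moments = moment_int_4[of "UNIV :: 8 set" "($) x", OF finite, unfolded n arith]
    moment_odd_1[of "UNIV :: 8 set" "($) x", OF finite, unfolded n arith]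
    chi_moment_1[of "UNIV :: 8 set" "($) x", OF finite, unfolded n arith]
  show "M 0 = 2160" "M 2 = 1080" "M 4 = 1296" "M 6 = 2160" "M 10 = 15/2 * M 8 - 22680"
    unfolding M by (simp add: moments s1 fact_numeral; simp add: field_simps)+
qed

subsection \<open>Integrality and self-duality of the lattice\<close>

lemma E8_uminus: "x \<in> E8 \<Longrightarrow> - x \<in> E8"
proof -
  assume "x \<in> E8"
  then obtain k :: int where k: "(\<Sum>i\<in>UNIV. x $ i) = 2 * of_int k"
    and x: "(\<forall>i. x $ i \<in> \<int>) \<or> (\<forall>i. x $ i - 1/2 \<in> \<int>)" unfolding E8_def by auto
  have "- t - 1/2 \<in> \<int>" if "t - 1/2 \<in> \<int>" for t :: real
    using Ints_diff[OF Ints_minus[OF that] Ints_1] by (simp add: algebra_simps)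
  moreover have "(\<Sum>i\<in>UNIV. (- x) $ i) = 2 * of_int (- k)" using k by (simp add: sum_negf)
  ultimately show ?thesis using x unfolding E8_def by (auto intro!: exI[of _ "- k"])
qed

lemma E8_inner_Ints:
  assumes "x \<in> E8" "y \<in> E8"
  shows "x \<bullet> y \<in> \<int>"
proof -
  have ii: "intvec a \<bullet> intvec b \<in> \<int>" for a b
    unfolding intvec_def inner_vec_def by (auto intro!: Ints_sum Ints_mult)
  have ih: "intvec a \<bullet> halfvec b \<in> \<int>" if "even (\<Sum>i\<in>UNIV. a i)" "\<forall>i. odd (b i)" for a b
  proof -
    have "even (\<Sum>i\<in>UNIV. a i * (b i - 1))" using that(2) by (intro dvd_sum) auto
    then have "even (\<Sum>i\<in>UNIV. a i * b i)"
      using that(1) by (simp add: algebra_simps sum_subtractf)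
    then obtain k where "(\<Sum>i\<in>UNIV. a i * b i) = 2 * k" by (elim dvdE)
    then have "intvec a \<bullet> halfvec b = of_int k"
      unfolding intvec_def halfvec_def inner_vec_def
      by (simp flip: sum_divide_distrib of_int_mult of_int_sum)
    then show ?thesis by simp
  qed
  have hh: "halfvec a \<bullet> halfvec b \<in> \<int>"
    if "\<forall>i. odd (a i)" "4 dvd (\<Sum>i\<in>UNIV. a i)" "\<forall>i. odd (b i)" "4 dvd (\<Sum>i\<in>UNIV. b i)" for a b
  proof -
    \<comment> \<open>Each factor is even; expanding the product leaves the wanted sum modulo 4, as
      both coordinate sums and the dimension 8 are divisible by 4.\<close>
    have "4 dvd (\<Sum>i\<in>UNIV. (a i - 1) * (b i - 1))"
    proof (rule dvd_sum)
      fix i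
      have "2 dvd a i - 1" "2 dvd b i - 1" using that(1,3) by auto
      from mult_dvd_mono[OF this] show "4 dvd (a i - 1) * (b i - 1)" by simp
    qed
    moreover have "(\<Sum>i\<in>UNIV. (a i - 1) * (b i - 1))
      = (\<Sum>i\<in>UNIV. a i * b i) - (\<Sum>i\<in>UNIV. a i) - (\<Sum>i\<in>UNIV. b i) + 8"
      by (simp add: algebra_simps sum_subtractf sum.distrib)
    ultimately have "4 dvd (\<Sum>i\<in>UNIV. a i * b i)" using that(2,4) by presburger
    then obtain k where "(\<Sum>i\<in>UNIV. a i * b i) = 4 * k" by (elim dvdE)
    then have "halfvec a \<bullet> halfvec b = of_int k"
      unfolding halfvec_def inner_vec_def
      by (simp flip: sum_divide_distrib of_int_mult of_int_sum)
    then show ?thesis by simp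
  qed
  show ?thesis
    using assms ii ih hh unfolding E8_eq by (auto simp: inner_commute[of "halfvec _" "intvec _"])
qed

lemma in_E8_if_dual:
  fixes w :: "real^8"
  assumes 2: "\<And>i. 2 * w $ i \<in> \<int>" and diff: "\<And>i j. w $ i - w $ j \<in> \<int>"
    and sum: "(\<Sum>i\<in>UNIV. w $ i) / 2 \<in> \<int>"
  shows "w \<in> E8"
proof -
  obtain s :: int where "(\<Sum>i\<in>UNIV. w $ i) / 2 = of_int s" using sum by (elim Ints_cases)
  then have "(\<Sum>i\<in>UNIV. w $ i) = 2 * of_int s" by simp
  moreover have "(\<forall>i. w $ i \<in> \<int>) \<or> (\<forall>i. w $ i - 1/2 \<in> \<int>)"
  proof -
    obtain k :: int where k: "2 * w $ 1 = of_int k" using 2[of 1] by (elim Ints_cases)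
    show ?thesis
    proof (cases "even k")
      case True
      then have "w $ 1 = of_int (k div 2)" using k by (auto elim!: evenE)
      then have "w $ 1 \<in> \<int>" by simp
      then have "w $ i \<in> \<int>" for i using Ints_add[OF diff[of i 1], of "w $ 1"] by simp
      then show ?thesis by blast
    next
      case False
      then have "w $ 1 - 1/2 = of_int (k div 2)" using k by (auto elim!: oddE)
      then have "w $ 1 - 1/2 \<in> \<int>" by simp
      then have "w $ i - 1/2 \<in> \<int>" for i using Ints_add[OF diff[of i 1], of "w $ 1 - 1/2"] by simp
      then show ?thesis by blast
    qed
  qed
  ultimately show ?thesis unfolding E8_def by blast
qed

lemma of_bool_square: "(of_bool P)\<^sup>2 = (of_bool P :: int)"
  by simp

lemma intvec_in_shell:
  "even (\<Sum>i\<in>UNIV. a i) \<Longrightarrow> (\<Sum>i\<in>UNIV. (a i)\<^sup>2) = n \<Longrightarrow> intvec a \<in> {v \<in> E8. (norm v)\<^sup>2 = of_int n}"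
  by (auto simp: E8_eq norm_intvec simp del: of_int_sum)

lemma halfvec_in_shell:
  "\<forall>i. odd (a i) \<Longrightarrow> 4 dvd (\<Sum>i\<in>UNIV. a i) \<Longrightarrow> (\<Sum>i\<in>UNIV. (a i)\<^sup>2) = 4 * n
    \<Longrightarrow> halfvec a \<in> {v \<in> E8. (norm v)\<^sup>2 = of_int n}"
  by (auto simp: E8_eq norm_halfvec simp del: of_int_sum)

text \<open>Self-duality tested on the roots \<open>e_i + e_j\<close>, \<open>e_i - e_j\<close> and
  half the all-ones vector, which supply the hypotheses of \<open>in_E8_if_dual\<close>.\<close>

lemma in_E8_if_dual_roots:
  assumes "\<And>v. v \<in> E8 \<Longrightarrow> (norm v)\<^sup>2 = 2 \<Longrightarrow> w \<bullet> v \<in> \<int>"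
  shows "w \<in> E8"
proof -
  have dual: "w \<bullet> v \<in> \<int>" if "v \<in> {v \<in> E8. (norm v)\<^sup>2 = of_int 2}" for v using that assms by simp
  have diff: "w $ i - w $ j \<in> \<int>" and add: "w $ i + w $ j \<in> \<int>" if "i \<noteq> j" for i j
  proof -
    have "(of_bool (k = i) - of_bool (k = j))\<^sup>2 = of_bool (k = i) + (of_bool (k = j) :: int)"
      "(of_bool (k = i) + of_bool (k = j))\<^sup>2 = of_bool (k = i) + (of_bool (k = j) :: int)" for k
      using that by auto
    then have "w \<bullet> intvec (\<lambda>k. of_bool (k = i) - of_bool (k = j)) \<in> \<int>"
      "w \<bullet> intvec (\<lambda>k. of_bool (k = i) + of_bool (k = j)) \<in> \<int>"
      by (intro dual intvec_in_shell; simp add: sum.distrib sum_subtractf)+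
    then show "w $ i - w $ j \<in> \<int>" "w $ i + w $ j \<in> \<int>"
      unfolding inner_intvec by (simp_all add: algebra_simps sum.distrib sum_subtractf)
  qed
  show ?thesis
  proof (rule in_E8_if_dual)
    fix i :: 8
    obtain j :: 8 where "i \<noteq> j" using ex_card[of 2 "UNIV :: 8 set"] by (metis zero_neq_one)
    from Ints_add[OF diff[OF this] add[OF this]] show "2 * w $ i \<in> \<int>" by simp
  next
    show "w $ i - w $ j \<in> \<int>" for i j using diff[of i j] by (cases "i = j") auto
    have "w \<bullet> halfvec (\<lambda>_. 1) \<in> \<int>" by (intro dual halfvec_in_shell) auto
    then show "(\<Sum>i\<in>UNIV. w $ i) / 2 \<in> \<int>" unfolding inner_halfvec by simp
  qed
qed

lemma in_E8_if_dual_norm_4: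
  assumes "\<And>v. v \<in> E8 \<Longrightarrow> (norm v)\<^sup>2 = 4 \<Longrightarrow> w \<bullet> v \<in> \<int>"
  shows "w \<in> E8"
proof -
  have dual: "w \<bullet> v \<in> \<int>" if "v \<in> {v \<in> E8. (norm v)\<^sup>2 = of_int 4}" for v using that assms by simp
  have diff: "w $ i - w $ j \<in> \<int>" for i j
  proof -
    \<comment> \<open>Three coordinates \<open>T\<close> away from \<open>i\<close> and
      \<open>j\<close> complete \<open>e_i\<close> and \<open>e_j\<close> to vectors of squared norm
      4; these differ by \<open>e_i - e_j\<close>.\<close>
    have "3 \<le> card (UNIV - {i, j})"
      using card_Diff_subset[of "{i, j}" UNIV] card_insert_le_m1[of 2 "{j}" i] by simp
    then obtain T where T: "T \<subseteq> UNIV - {i, j}" "card T = 3" by (meson obtain_subset_with_card_n)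
    have "w \<bullet> intvec (\<lambda>k. of_bool (k = m) + of_bool (k \<in> T)) \<in> \<int>" if "m \<in> {i, j}" for m
    proof -
      have "(of_bool (k = m) + of_bool (k \<in> T))\<^sup>2 = of_bool (k = m) + (of_bool (k \<in> T) :: int)" for k
        using T that by auto
      then show ?thesis
        using T by (intro dual intvec_in_shell) (simp_all add: sum.distrib)
    qed
    from Ints_diff[OF this[of i] this[of j]] show ?thesis
      unfolding inner_intvec by (simp add: distrib_right sum.distrib)
  qed
  show ?thesis
  proof (rule in_E8_if_dual)
    fix i
    have "w \<bullet> intvec (\<lambda>k. 2 * of_bool (k = i)) \<in> \<int>"
      by (intro dual intvec_in_shell) (simp_all add: power_mult_distrib of_bool_square flip: sum_distrib_left)
    then show "2 * w $ i \<in> \<int>" unfolding inner_intvec by (simp add: mult.assoc flip: sum_distrib_left)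
  next
    \<comment> \<open>Half of (3, -1, 1, ..., 1) has squared norm 16/4 = 4. Its inner product with
      \<open>w\<close> is half the coordinate sum plus \<open>w $ 0 - w $ 1\<close>, an integer by
      \<open>diff\<close>.\<close>
    have "(1 + 2 * of_bool (k = 0) - 2 * of_bool (k = 1))\<^sup>2 = 1 + 8 * (of_bool (k = 0) :: int)" for k :: 8
      by auto
    then have "w \<bullet> halfvec (\<lambda>k. 1 + 2 * of_bool (k = 0) - 2 * of_bool (k = 1)) \<in> \<int>"
      by (intro dual halfvec_in_shell) (simp_all add: sum.distrib sum_subtractf flip: sum_distrib_left)
    moreover have "w \<bullet> halfvec (\<lambda>k. 1 + 2 * of_bool (k = 0) - 2 * of_bool (k = 1))
        = (\<Sum>i\<in>UNIV. w $ i) / 2 + (w $ 0 - w $ 1)"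
      unfolding inner_halfvec
      by (simp add: distrib_right left_diff_distrib sum.distrib sum_subtractf mult.assoc
          flip: sum_distrib_left)
    ultimately show "(\<Sum>i\<in>UNIV. w $ i) / 2 \<in> \<int>"
      using Ints_diff[OF _ diff[of 0 1]] by fastforce
  qed (rule diff)
qed

text \<open>The inner product of \<open>u\<close> and \<open>v\<close> is an integer whose square is
  at most 2 * 4 by Cauchy-Schwarz, hence of modulus at most 2; scaling divides it by
  \<open>2 * sqrt 2\<close>.\<close>

lemma E8_inner_nodes:
  assumes "u \<in> E8" "(norm u)\<^sup>2 = 2" "v \<in> E8" "(norm v)\<^sup>2 = 4"
  shows "(u /\<^sub>R sqrt 2) \<bullet> (v /\<^sub>R 2) \<in> nodes"
proof -
  obtain k :: int where k: "u \<bullet> v = of_int k" using E8_inner_Ints[OF assms(1,3)] by (elim Ints_cases)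
  have "(u \<bullet> v)\<^sup>2 \<le> 8"
    using Cauchy_Schwarz_ineq[of u v] assms(2,4) by (simp add: power2_norm_eq_inner)
  then have "k\<^sup>2 \<le> 8" unfolding k by (simp flip: of_int_power)
  then have "\<bar>k\<bar> < 3" using abs_le_square_iff[of 3 k] by auto
  then have "k = 0 \<or> \<bar>k\<bar> = 1 \<or> \<bar>k\<bar> = 2" by linarith
  then have "k\<^sup>2 = 0 \<or> k\<^sup>2 = 1 \<or> k\<^sup>2 = 4"
    by (metis power2_abs one_power2 power_zero_numeral power2_eq_square numeral_times_numeral semiring_norm(13,11,12,6,2))
  then have "(real_of_int k)\<^sup>2 = 0 \<or> (real_of_int k)\<^sup>2 = 1 \<or> (real_of_int k)\<^sup>2 = 4"
    by (metis of_int_power of_int_0 of_int_1 of_int_numeral)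
  moreover have "((u /\<^sub>R sqrt 2) \<bullet> (v /\<^sub>R 2))\<^sup>2 = (real_of_int k)\<^sup>2 / 8"
    by (simp add: k power_mult_distrib power_inverse field_simps)
  ultimately show ?thesis unfolding nodes_iff by auto
qed

lemma nodes_scaled_Ints: "t \<in> nodes \<Longrightarrow> 2 * sqrt 2 * t \<in> \<int>"
proof -
  have "2 * sqrt 2 * (sqrt 2 / 4) = 1" "2 * sqrt 2 * (sqrt 2 / 2) = 2" by simp_all
  then show "t \<in> nodes \<Longrightarrow> 2 * sqrt 2 * t \<in> \<int>"
    unfolding nodes_def by (elim insertE; simp only: mult_minus_right; simp)
qed

text \<open>Conversely, if all inner products are nodes, \<open>2 *\<^sub>R x\<close> pairs
  integrally with every root, because \<open>2 * sqrt 2\<close> times a node is an integer;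
  self-duality then places it in the lattice.\<close>

lemma C2160_dual: "C2160 = {x \<in> sphere 0 1. \<forall>y\<in>C240. x \<bullet> y \<in> nodes}"
proof (intro equalityI subsetI)
  fix x assume "x \<in> C2160"
  then show "x \<in> {x \<in> sphere 0 1. \<forall>y\<in>C240. x \<bullet> y \<in> nodes}"
    using C2160_sphere E8_inner_nodes unfolding C240_def C2160_def
    by (auto simp: inner_commute simp del: inner_scaleR_left inner_scaleR_right)
next
  fix x :: "real^8" assume x: "x \<in> {x \<in> sphere 0 1. \<forall>y\<in>C240. x \<bullet> y \<in> nodes}"
  have "2 *\<^sub>R x \<in> E8"
  proof (rule in_E8_if_dual_roots)
    fix v assume "v \<in> E8" "(norm v)\<^sup>2 = 2"
    then have "x \<bullet> (v /\<^sub>R sqrt 2) \<in> nodes" using x unfolding C240_def by blast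
    from nodes_scaled_Ints[OF this] show "2 *\<^sub>R x \<bullet> v \<in> \<int>" by (simp add: field_simps)
  qed
  moreover have "(norm (2 *\<^sub>R x))\<^sup>2 = 4" using x by simp
  ultimately show "x \<in> C2160" unfolding C2160_def by (intro image_eqI[of _ _ "2 *\<^sub>R x"]) auto
qed

lemma C240_dual: "C240 = {x \<in> sphere 0 1. \<forall>y\<in>C2160. x \<bullet> y \<in> nodes}"
proof (intro equalityI subsetI)
  fix x assume "x \<in> C240"
  then show "x \<in> {x \<in> sphere 0 1. \<forall>y\<in>C2160. x \<bullet> y \<in> nodes}"
    using C240_sphere E8_inner_nodes unfolding C240_def C2160_def
    by (auto simp del: inner_scaleR_left inner_scaleR_right)
next
  fix x :: "real^8" assume x: "x \<in> {x \<in> sphere 0 1. \<forall>y\<in>C2160. x \<bullet> y \<in> nodes}"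
  have "sqrt 2 *\<^sub>R x \<in> E8"
  proof (rule in_E8_if_dual_norm_4)
    fix v assume "v \<in> E8" "(norm v)\<^sup>2 = 4"
    then have "x \<bullet> (v /\<^sub>R 2) \<in> nodes" using x unfolding C2160_def by blast
    from nodes_scaled_Ints[OF this] show "sqrt 2 *\<^sub>R x \<bullet> v \<in> \<int>" by (simp add: field_simps)
  qed
  moreover have "(norm (sqrt 2 *\<^sub>R x))\<^sup>2 = 2" using x by (simp add: power_mult_distrib)
  ultimately show "x \<in> C240" unfolding C240_def by (intro image_eqI[of _ _ "sqrt 2 *\<^sub>R x"]) auto
qed

subsection \<open>The two codes\<close>

lemma zonal_moment_scaled:
  assumes "c \<noteq> 0"
  shows "zonal_moment ((\<lambda>v. v /\<^sub>R c) ` S) x k = zonal_moment S x k / c ^ k"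
proof -
  have "inj_on (\<lambda>v. v /\<^sub>R c) S" using assms by (auto intro: inj_onI)
  then show ?thesis
    by (simp add: sum.reindex power_mult_distrib sum_divide_distrib field_simps)
qed

lemma polar_code_C240: "polar_code C240 C2160 (- 315 / 128)" and card_C240: "card C240 = 240"
proof -
  define S where "S = {v \<in> E8. (norm v)\<^sup>2 = 2}"
  have fin: "finite C240" using sum_E8_shell(1)[of 2] unfolding C240_def by simp
  have m: "zonal_moment C240 x k = zonal_moment S x k / sqrt 2 ^ k" for x k
    unfolding C240_def S_def by (rule zonal_moment_scaled) simp
  have pw: "sqrt 2 ^ 4 = 4" "sqrt 2 ^ 6 = 8" "sqrt 2 ^ 8 = 16" "sqrt 2 ^ 10 = 32"
    by (simp_all add: eval_nat_numeral)
  have ax: "axis 1 1 \<in> sphere (0 :: real^8) 1" by simp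
  note M = E8_moments_2[folded S_def]
  \<comment> \<open>The cardinality is the moment of degree 0, read off at an arbitrary unit
    vector.\<close>
  show c: "card C240 = 240" using m[of "axis 1 1" 0] M(1)[OF ax] by simp
  show "polar_code C240 C2160 (- 315 / 128)"
  proof
    show "- y \<in> C240" if "y \<in> C240" for y
      using that unfolding C240_def by (auto intro!: image_eqI[where x = "- _"] E8_uminus)
    have "intvec (\<lambda>k. 2 * of_bool (k = 1)) \<in> {v \<in> E8. (norm v)\<^sup>2 = of_int 4}"
      by (intro intvec_in_shell) (simp_all add: power_mult_distrib of_bool_square flip: sum_distrib_left)
    then show "C2160 \<noteq> {}" unfolding C2160_def by auto
  qed (use fin C240_sphere C2160_dual in \<open>simp_all add: m M pw c\<close>)
qed

lemma polar_code_C2160: "polar_code C2160 C240 (- 2835 / 128)" and card_C2160: "card C2160 = 2160"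
proof -
  define S where "S = {v \<in> E8. (norm v)\<^sup>2 = 4}"
  have fin: "finite C2160" using sum_E8_shell(1)[of 4] unfolding C2160_def by simp
  have m: "zonal_moment C2160 x k = zonal_moment S x k / 2 ^ k" for x k
    unfolding C2160_def S_def by (rule zonal_moment_scaled) simp
  have ax: "axis 1 1 \<in> sphere (0 :: real^8) 1" by simp
  note M = E8_moments_4[folded S_def]
  show c: "card C2160 = 2160" using m[of "axis 1 1" 0] M(1)[OF ax] by simp
  show "polar_code C2160 C240 (- 2835 / 128)"
  proof
    show "- y \<in> C2160" if "y \<in> C2160" for y
      using that unfolding C2160_def by (auto intro!: image_eqI[where x = "- _"] E8_uminus)
    show "C240 \<noteq> {}" using card_C240 by auto
  qed (use fin C2160_sphere C240_dual in \<open>simp_all add: m M c\<close>)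
qed

theorem theorem4p1:
  shows "(\<forall>h. potential h \<and> times_differentiable 10 h \<and>
           (\<forall>t\<in>{-1<..<1}. hderiv 8 h t > 0 \<and> hderiv 9 h t > 0 \<and> hderiv 10 h t > 0) \<longrightarrow>
           polarization h C240 =
             14 * h (- (sqrt 2 / 2)) + 64 * h (- (sqrt 2 / 4)) + 84 * h 0
               + 64 * h (sqrt 2 / 4) + 14 * h (sqrt 2 / 2) \<and>
           polarization h C2160 =
             126 * h (- (sqrt 2 / 2)) + 576 * h (- (sqrt 2 / 4)) + 756 * h 0
               + 576 * h (sqrt 2 / 4) + 126 * h (sqrt 2 / 2) \<and>
           polarization h C240 / 240 = polarization h C2160 / 2160)
       \<and> universal_polar_dual_pair C240 C2160"
proof (intro conjI allI impI)
  fix h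
  assume h: "potential h \<and> times_differentiable 10 h \<and>
    (\<forall>t\<in>{-1<..<1}. hderiv 8 h t > 0 \<and> hderiv 9 h t > 0 \<and> hderiv 10 h t > 0)"
  define H where "H t = real_of_ereal (h t)" for t
  have hH: "h t = ereal (H t)" if "t \<in> nodes" for t
    using that nodes_subset h unfolding potential_def H_def
    by (intro ereal_real'[symmetric]) force
  have n: "0 \<in> nodes" "sqrt 2 / 4 \<in> nodes" "- (sqrt 2 / 4) \<in> nodes"
    "sqrt 2 / 2 \<in> nodes" "- (sqrt 2 / 2) \<in> nodes" by (auto simp: nodes_def)
  have num: "(numeral m :: ereal) = ereal (numeral m)" for m by simp
  have p240: "polarization h C240 = ereal (polar_code.dual_value C240 h)"
    and p2160: "polarization h C2160 = ereal (polar_code.dual_value C2160 h)"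
    using polar_code.polarization_eq(1)[OF polar_code_C240]
      polar_code.polarization_eq(1)[OF polar_code_C2160] h by blast+
  note v = polar_code.dual_value_def[OF polar_code_C240, of h, folded H_def, unfolded card_C240 Let_def]
    polar_code.dual_value_def[OF polar_code_C2160, of h, folded H_def, unfolded card_C2160 Let_def]
  show "polarization h C240 =
             14 * h (- (sqrt 2 / 2)) + 64 * h (- (sqrt 2 / 4)) + 84 * h 0
               + 64 * h (sqrt 2 / 4) + 14 * h (sqrt 2 / 2)"
    unfolding p240 v n[THEN hH] num by simp
  show "polarization h C2160 =
             126 * h (- (sqrt 2 / 2)) + 576 * h (- (sqrt 2 / 4)) + 756 * h 0
               + 576 * h (sqrt 2 / 4) + 126 * h (sqrt 2 / 2)"
    unfolding p2160 v n[THEN hH] num by simp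
  show "polarization h C240 / 240 = polarization h C2160 / 2160"
    unfolding p240 p2160 v num by simp
next
  show "universal_polar_dual_pair C240 C2160"
    \<comment> \<open>Strict absolute monotonicity supplies the differentiability and the signs in
      orders 8 and 10, so \<open>polarization_eq\<close> applies to each code with the other one as
      its dual.\<close>
    unfolding universal_polar_dual_pair_def strictly_absolutely_monotone_def
    using polar_code.polarization_eq(2)[OF polar_code_C240]
      polar_code.polarization_eq(2)[OF polar_code_C2160] by blast
qed

end
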